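(* Let $K$ be an algebraic number field with ring of integers $\mathcal{O}_K$, let $\mathbf{X}\in\mathbb{Z}^{n\times n}$ be a symmetric matrix, and suppose that a nonzero matrix $\mathbf{Q}\in K^{n\times n}$ satisfies $\mathbf{Q}^{\mathsf T}\mathbf{Q}\in\mathcal{O}_K^{n\times n}$ and $\mathbf{X}\mathbf{Q}=\mathbf{Q}\mathbf{Y}$ for some $\mathbf{Y}\in\mathcal{O}_K^{n\times n}$. Let $\mathcal{L}\subseteq\mathcal{O}_K$ be the level of $\mathbf{Q}$. If $\mathcal{P}\mid\mathcal{L}$ for a nonzero prime ideal $\mathcal{P}\subseteq\mathcal{O}_K$, then $\mathcal{P}$ lies above a prime $p\in\mathbb{Z}_{\geq 2}$ with $p\mid\Delta_{\mathbf{X}}$. Moreover, if $p^2\nmid\Delta_{\mathbf{X}}$, then the prime $p$ is ramified in $K$ and it holds that $\mathcal{P}^2\mid p\mathcal{O}_K$.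
   Context: The level of $\mathbf{Q}$ is the ideal $\mathcal{L}=\{r\in\mathcal{O}_K: r\mathbf{Q}\in\mathcal{O}_K^{n\times n}\}$. For ideals, $\mathcal{B}\mid\mathcal{A}$ means $\mathcal{B}\mathcal{C}=\mathcal{A}$ for some ideal $\mathcal{C}$. With $\phi_{\mathbf{X}}(x)=\det(x\mathbf{I}-\mathbf{X})$, the discriminant is $\Delta_{\mathbf{X}}=\det(\phi_{\mathbf{X}}'(\mathbf{X}))\in\mathbb{Z}$. A nonzero prime ideal $\mathcal{P}$ lies above the prime number $p$ if $\mathcal{P}\cap\mathbb{Z}=p\mathbb{Z}$. A prime number $p$ is ramified in $K$ if there is a nonzero prime ideal $\mathcal{P}'\subseteq\mathcal{O}_K$ with $\mathcal{P}'^2\mid p\mathcal{O}_K$. *)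

theory Defs
  imports
    "HOL-Algebra.Ideal_Product"
    "HOL-Computational_Algebra.Computational_Algebra"
    "Jordan_Normal_Form.Char_Poly"
begin

text \<open>
  A number field is a type: a field of characteristic 0 (which therefore contains the rationals,
  via \<^const>\<open>of_rat\<close>) that has finite dimension as a vector space over them.
\<close>

definition number_field :: "'k::field_char_0 itself \<Rightarrow> bool" where
  "number_field _ \<longleftrightarrow>
     (\<exists>B. finite_dimensional_vector_space (\<lambda>(q::rat) (x::'k). of_rat q * x) B)"

lemma number_field_rat: "number_field TYPE(rat)"
proof -
  interpret vector_space "\<lambda>(q::rat) (x::rat). of_rat q * x"
    by unfold_locales (simp_all add: algebra_simps of_rat_add of_rat_mult)
  have "x \<in> span {1}" for x :: rat
    using span_scale[OF span_base[of 1 "{1}"], of x] by simp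
  moreover have "independent {1}"
    by (simp only: dependent_single)
  ultimately have "finite_dimensional_vector_space (\<lambda>(q::rat) (x::rat). of_rat q * x) {1}"
    by unfold_locales auto
  then show ?thesis
    unfolding number_field_def by blast
qed

text \<open>
  The ring of integers, as a HOL-Algebra structure, so that ideals, prime ideals and products of
  ideals are those of HOL-Algebra.
\<close>

definition ring_of_integers :: "'k::field_char_0 ring" where
  "ring_of_integers =
     \<lparr>carrier = {x. algebraic_int x}, monoid.mult = (*), one = 1, ring.zero = 0, add = (+)\<rparr>"

notation ring_of_integers (\<open>\<O>\<^sub>K\<close>)

definition integral_mat :: "'k::field_char_0 mat \<Rightarrow> bool" where
  "integral_mat A \<longleftrightarrow> elements_mat A \<subseteq> carrier \<O>\<^sub>K"

definition level :: "'k::field_char_0 mat \<Rightarrow> 'k set" where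
  "level Q = {r \<in> carrier \<O>\<^sub>K. integral_mat (r \<cdot>\<^sub>m Q)}"

definition ideal_dvd :: "'k::field_char_0 set \<Rightarrow> 'k set \<Rightarrow> bool" where
  "ideal_dvd B A \<longleftrightarrow> (\<exists>C. ideal C \<O>\<^sub>K \<and> ideal_prod \<O>\<^sub>K B C = A)"

definition nonzero_prime_ideal :: "'k::field_char_0 set \<Rightarrow> bool" where
  "nonzero_prime_ideal P \<longleftrightarrow> primeideal P \<O>\<^sub>K \<and> P \<noteq> {0}"

definition lies_above :: "'k::field_char_0 set \<Rightarrow> nat \<Rightarrow> bool" where
  "lies_above P p \<longleftrightarrow> P \<inter> \<int> = of_int ` {k. int p dvd k}"

definition ramified :: "'k::field_char_0 itself \<Rightarrow> nat \<Rightarrow> bool" where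
  "ramified _ p \<longleftrightarrow>
     (\<exists>P::'k set. nonzero_prime_ideal P \<and> ideal_dvd (ideal_prod \<O>\<^sub>K P P) (PIdl\<^bsub>\<O>\<^sub>K\<^esub> of_nat p))"

text \<open>The value \<open>f(A)\<close> of a polynomial at a square matrix, given entry by entry.\<close>

definition poly_at_mat :: "'a::comm_ring_1 poly \<Rightarrow> 'a mat \<Rightarrow> 'a mat" where
  "poly_at_mat f A =
     mat (dim_row A) (dim_row A) (\<lambda>(i, j). \<Sum>k\<le>degree f. coeff f k * (A ^\<^sub>m k) $$ (i, j))"

definition mat_discriminant :: "int mat \<Rightarrow> int" where
  "mat_discriminant X = det (poly_at_mat (pderiv (char_poly X)) X)"

end

theory Submission
  imports Defs "HOL-Algebra.Algebraic_Closure_Type"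
begin

text \<open>
  Let \<open>\<Delta> = det M\<close> with \<open>M = \<phi>'(X)\<close>. The claim reduces to: \<open>\<Delta> * q^2\<close> is an algebraic
  integer for every entry \<open>q\<close> of \<open>Q\<close>. If \<open>\<Delta> \<noteq> 0\<close>, then over the algebraic closure \<open>X\<close> has
  distinct eigenvalues \<open>e k\<close> and an orthogonal basis of eigenvectors, so with
  \<open>R k = (\<Prod>l \<noteq> k. X - e l)\<close>, a symmetric matrix of rank one, and a column \<open>u\<close> of \<open>Q\<close>,
  the vanishing of 2 by 2 minors gives \<open>((R k) u)_i^2 = (R k)_ii * (u \<bullet> (R k) u)\<close>. The right-hand
  side is integral because \<open>Q^T Q\<close> and \<open>Y\<close> are. Hence \<open>M u = (\<Sum>k. (R k) u)\<close> is integral, and so is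
  \<open>u \<bullet> M u\<close>; replacing the \<open>i\<close>-th row and column of the symmetric matrix \<open>M\<close> by those
  of \<open>M u\<close>, with \<open>u \<bullet> M u\<close> on the diagonal, gives an integral matrix of determinant \<open>u_i^2 * \<Delta>\<close>.

  If \<open>P\<close> divides the level, some entry \<open>q\<close> has all its denominators in \<open>P\<close>, and invertibility of
  \<open>P\<close> yields \<open>r \<in> P\<close> with \<open>r * q\<close> integral and outside \<open>P\<close>. Then \<open>\<Delta> * (r * q)^2 \<in> P^2\<close> forces
  \<open>\<Delta> \<in> P^2\<close>. So \<open>p\<close> divides \<open>\<Delta>\<close>, and if \<open>p^2\<close> does not, then \<open>p\<close> is an integral combination of
  \<open>\<Delta>\<close> and \<open>p^2\<close>, hence lies in \<open>P^2\<close>.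
\<close>

no_notation fps_nth (infixl \<open>$\<close> 75)
no_notation var (\<open>X\<index>\<close>)

section \<open>The ring of algebraic integers\<close>

lemma algebraic_int_eigenvalue:
  fixes x :: "'a::field_char_0"
  assumes A: "A \<in> carrier_mat m m" and ev: "eigenvalue (map_mat of_int A) x"
  shows "algebraic_int x"
proof -
  have "poly (map_poly of_int (char_poly A)) x = 0"
    using ev A by (simp add: eigenvalue_root_char_poly[of _ m] of_int_hom.char_poly_hom[of _ m])
  moreover have "Polynomial.lead_coeff (char_poly A) = 1"
    using degree_monic_char_poly[OF A] by simp
  ultimately show ?thesis
    unfolding algebraic_int_altdef_ipoly by blast
qed

text \<open>Multiplication by \<open>x\<close> maps the Z-module generated by the family
  \<open>f\<close> into itself, expressed on generators; the family may be linearly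
  dependent.\<close>

definition int_stable :: "'i set \<Rightarrow> ('i \<Rightarrow> 'a::comm_ring_1) \<Rightarrow> 'a \<Rightarrow> bool" where
  "int_stable I f x \<longleftrightarrow> (\<forall>i\<in>I. \<exists>c::'i \<Rightarrow> int. x * f i = (\<Sum>j\<in>I. of_int (c j) * f j))"

lemma int_stable_add:
  assumes "int_stable I f x" "int_stable I f y"
  shows "int_stable I f (x + y)"
  unfolding int_stable_def
proof
  fix i assume "i \<in> I"
  then obtain c d where "x * f i = (\<Sum>j\<in>I. of_int (c j) * f j)" "y * f i = (\<Sum>j\<in>I. of_int (d j) * f j)"
    using assms unfolding int_stable_def by blast
  then have "(x + y) * f i = (\<Sum>j\<in>I. of_int (c j + d j) * f j)"
    by (simp add: algebra_simps sum.distrib)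
  then show "\<exists>c. (x + y) * f i = (\<Sum>j\<in>I. of_int (c j) * f j)" by (rule exI[of _ "\<lambda>j. c j + d j"])
qed

lemma int_stable_mult:
  assumes "int_stable I f x" "int_stable I f y"
  shows "int_stable I f (x * y)"
  unfolding int_stable_def
proof
  fix i assume i: "i \<in> I"
  obtain C where C: "x * f i = (\<Sum>j\<in>I. of_int (C i j) * f j)" if "i \<in> I" for i
    using assms(1) unfolding int_stable_def by metis
  obtain d where d: "y * f i = (\<Sum>j\<in>I. of_int (d j) * f j)"
    using i assms(2) unfolding int_stable_def by metis
  have "(x * y) * f i = (\<Sum>j\<in>I. of_int (d j) * (x * f j))"
    using d by (simp add: mult.assoc mult.left_commute[of x] sum_distrib_left)
  also have "\<dots> = (\<Sum>j\<in>I. \<Sum>k\<in>I. of_int (d j * C j k) * f k)"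
    by (intro sum.cong refl) (simp add: C sum_distrib_left mult.assoc)
  also have "\<dots> = (\<Sum>k\<in>I. of_int (\<Sum>j\<in>I. d j * C j k) * f k)"
    by (subst sum.swap) (simp add: sum_distrib_right)
  finally show "\<exists>c. (x * y) * f i = (\<Sum>j\<in>I. of_int (c j) * f j)"
    by (rule exI[of _ "\<lambda>k. \<Sum>j\<in>I. d j * C j k"])
qed

text \<open>The determinant trick: the coefficients form an integer matrix that has the vector of
  generators as an eigenvector with eigenvalue \<open>x\<close>. The generator \<open>f i0\<close>
  makes this vector nonzero.\<close>

lemma algebraic_int_if_int_stable:
  fixes x :: "'a::field_char_0"
  assumes I: "finite I" and st: "int_stable I f x" and nz: "i0 \<in> I" "f i0 \<noteq> 0"
  shows "algebraic_int x"
proof -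
  define m where "m = card I"
  obtain h where h: "bij_betw h {0..<m} I"
    using ex_bij_betw_nat_finite[OF I] m_def by blast
  have hI: "h i \<in> I" if "i < m" for i
    using h that unfolding bij_betw_def by auto
  obtain C where C: "\<And>i. i \<in> I \<Longrightarrow> x * f i = (\<Sum>j\<in>I. of_int (C i j) * f j)"
    using st unfolding int_stable_def by metis
  define A where "A = mat m m (\<lambda>(i, j). C (h i) (h j))"
  define v where "v = vec m (\<lambda>i. f (h i))"
  have A: "A \<in> carrier_mat m m" by (simp add: A_def)
  have "map_mat of_int A *\<^sub>v v = x \<cdot>\<^sub>v v"
  proof (rule eq_vecI)
    fix i assume i: "i < dim_vec (x \<cdot>\<^sub>v v)"
    then have i: "i < m" by (simp add: v_def)
    have "(map_mat of_int A *\<^sub>v v) $ i = (\<Sum>j\<in>{0..<m}. of_int (C (h i) (h j)) * f (h j))"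
      using i by (simp add: A_def v_def scalar_prod_def)
    also have "\<dots> = (\<Sum>j\<in>I. of_int (C (h i) j) * f j)"
      by (rule sum.reindex_bij_betw[OF h])
    finally show "(map_mat of_int A *\<^sub>v v) $ i = (x \<cdot>\<^sub>v v) $ i"
      using C[OF hI[OF i]] i by (simp add: v_def)
  qed (simp add: A_def v_def)
  moreover have "v \<noteq> 0\<^sub>v m"
  proof -
    obtain k where k: "k < m" "h k = i0"
      using h nz(1) unfolding bij_betw_def by (metis atLeastLessThan_iff imageE)
    then have "v $ k \<noteq> 0\<^sub>v m $ k" using nz by (simp add: v_def)
    then show ?thesis by auto
  qed
  ultimately have "eigenvalue (map_mat of_int A) x"
    unfolding eigenvalue_def eigenvector_def using A by (auto intro!: exI[of _ v] simp: v_def)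
  then show ?thesis by (rule algebraic_int_eigenvalue[OF A])
qed

lemma algebraic_int_power_relation:
  fixes x :: "'a::field_char_0"
  assumes "algebraic_int x"
  obtains m c where "m > 0" "x ^ m = (\<Sum>k<m. of_int (c k) * x ^ k)"
proof -
  obtain p where p: "poly (map_poly of_int p) x = 0" "Polynomial.lead_coeff p = 1"
    using assms unfolding algebraic_int_altdef_ipoly by blast
  define m where "m = Polynomial.degree p"
  have "0 = (\<Sum>k\<le>m. of_int (Polynomial.coeff p k) * x ^ k)"
    using p(1) unfolding poly_altdef m_def by simp
  also have "\<dots> = (\<Sum>k<m. of_int (Polynomial.coeff p k) * x ^ k) + x ^ m"
    using p(2) by (simp add: m_def lessThan_Suc_atMost[symmetric])
  finally have eq: "x ^ m = (\<Sum>k<m. of_int (- Polynomial.coeff p k) * x ^ k)"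
    by (simp add: sum_negf eq_neg_iff_add_eq_0 add.commute)
  \<comment> \<open>With \<open>m = 0\<close> the relation would read 1 = 0.\<close>
  moreover from eq have "m > 0" by (cases m) simp_all
  ultimately show thesis by (rule that[of m "\<lambda>k. - Polynomial.coeff p k", rotated])
qed

text \<open>Powers below the top are only shifted by one; at the top the relation \<open>rel\<close>
  brings \<open>x ^ m\<close> back into the span.\<close>

lemma int_span_powers_mult:
  fixes x z :: "'a::comm_ring_1"
  assumes m: "m > 0" and rel: "x ^ m = (\<Sum>k<m. of_int (c k) * x ^ k)" and k: "k < m"
  shows "\<exists>d::nat \<Rightarrow> int. x * x ^ k = (\<Sum>l<m. of_int (d l) * x ^ l)"
proof (cases "Suc k = m")
  case True
  then show ?thesis using rel by (intro exI[of _ c]) (simp flip: power_Suc)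
next
  case False
  have "x * x ^ k = (\<Sum>l<m. of_int (if l = Suc k then 1 else 0) * x ^ l)"
    using False k by (simp add: if_distrib[of "\<lambda>t. of_int t * _"] if_distrib[of of_int] cong: if_cong)
       (subst sum.mono_neutral_right[of _ "{Suc k}"]; auto)
  then show ?thesis by (rule exI[of _ "\<lambda>l. if l = Suc k then 1 else 0"])
qed

text \<open>A single module serves both elements, so their sum and product stabilise it too. It is
  Z[x, y], generated by the products \<open>x ^ i * y ^ j\<close> with exponents below the degrees
  of monic relations; the generator at (0, 0) is 1.\<close>

lemma algebraic_int_common_int_stable:
  fixes x y :: "'a::field_char_0"
  assumes "algebraic_int x" "algebraic_int y"
  obtains I :: "(nat \<times> nat) set" and f i0
  where "finite I" "int_stable I f x" "int_stable I f y" "i0 \<in> I" "f i0 \<noteq> (0::'a)"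
proof -
  obtain m c where m: "m > 0" "x ^ m = (\<Sum>k<m. of_int (c k) * x ^ k)"
    using algebraic_int_power_relation[OF assms(1)] .
  obtain n d where n: "n > 0" "y ^ n = (\<Sum>k<n. of_int (d k) * y ^ k)"
    using algebraic_int_power_relation[OF assms(2)] .
  let ?I = "{..<m} \<times> {..<n}" and ?f = "\<lambda>(i, j). x ^ i * y ^ j"
  have "int_stable ?I ?f x"
    unfolding int_stable_def
  proof (clarsimp)
    fix a b assume ab: "a < m" "b < n"
    obtain e where e: "x * x ^ a = (\<Sum>l<m. of_int (e l) * x ^ l)"
      using int_span_powers_mult[OF m ab(1)] by blast
    have "x * (x ^ a * y ^ b) = (\<Sum>l<m. of_int (e l) * (x ^ l * y ^ b))"
      by (simp add: mult.assoc[symmetric] e sum_distrib_right)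
    \<comment> \<open>A Kronecker delta turns the sum over one exponent into a sum over the index
      set \<open>?I\<close>.\<close>
    also have "\<dots> = (\<Sum>l<m. \<Sum>k<n. of_int (if k = b then e l else 0) * (x ^ l * y ^ k))"
      using ab(2) by (intro sum.cong refl) (simp add: if_distrib[of of_int] if_distrib[of "\<lambda>t. t * _"] cong: if_cong)
    also have "\<dots> = (\<Sum>j\<in>?I. of_int (case j of (l, k) \<Rightarrow> if k = b then e l else 0) * (case j of (i, j) \<Rightarrow> x ^ i * y ^ j))"
      by (simp add: sum.cartesian_product case_prod_unfold)
    finally show "\<exists>c. x * (x ^ a * y ^ b) = (\<Sum>j\<in>?I. of_int (c j) * (case j of (i, j) \<Rightarrow> x ^ i * y ^ j))"
      by blast
  qed
  moreover have "int_stable ?I ?f y"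
    unfolding int_stable_def
  proof (clarsimp)
    fix a b assume ab: "a < m" "b < n"
    obtain e where e: "y * y ^ b = (\<Sum>l<n. of_int (e l) * y ^ l)"
      using int_span_powers_mult[OF n ab(2)] by blast
    have "y * (x ^ a * y ^ b) = x ^ a * (y * y ^ b)" by (simp add: algebra_simps)
    also have "\<dots> = (\<Sum>k<n. of_int (e k) * (x ^ a * y ^ k))"
      by (simp add: e sum_distrib_left mult.left_commute)
    also have "\<dots> = (\<Sum>k<n. \<Sum>l<m. of_int (if l = a then e k else 0) * (x ^ l * y ^ k))"
      using ab(1) by (intro sum.cong refl) (simp add: if_distrib[of of_int] if_distrib[of "\<lambda>t. t * _"] cong: if_cong)
    also have "\<dots> = (\<Sum>j\<in>?I. of_int (case j of (l, k) \<Rightarrow> if l = a then e k else 0) * (case j of (i, j) \<Rightarrow> x ^ i * y ^ j))"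
      by (subst sum.swap) (simp add: sum.cartesian_product case_prod_unfold)
    finally show "\<exists>c. y * (x ^ a * y ^ b) = (\<Sum>j\<in>?I. of_int (c j) * (case j of (i, j) \<Rightarrow> x ^ i * y ^ j))"
      by blast
  qed
  ultimately show thesis
    using m(1) n(1) by (intro that[of ?I ?f "(0, 0)"]) auto
qed

lemma algebraic_int_add:
  fixes x y :: "'a::field_char_0"
  assumes "algebraic_int x" "algebraic_int y"
  shows "algebraic_int (x + y)"
  using algebraic_int_common_int_stable[OF assms]
  by (metis algebraic_int_if_int_stable int_stable_add)

lemma algebraic_int_mult:
  fixes x y :: "'a::field_char_0"
  assumes "algebraic_int x" "algebraic_int y"
  shows "algebraic_int (x * y)"
  using algebraic_int_common_int_stable[OF assms]
  by (metis algebraic_int_if_int_stable int_stable_mult)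

lemma algebraic_int_diff:
  fixes x y :: "'a::field_char_0"
  shows "algebraic_int x \<Longrightarrow> algebraic_int y \<Longrightarrow> algebraic_int (x - y)"
  using algebraic_int_add[of x "- y"] by simp

lemma algebraic_int_sum:
  fixes f :: "'i \<Rightarrow> 'a::field_char_0"
  shows "(\<And>i. i \<in> S \<Longrightarrow> algebraic_int (f i)) \<Longrightarrow> algebraic_int (sum f S)"
  by (induction S rule: infinite_finite_induct) (auto intro: algebraic_int_add)

lemma algebraic_int_prod:
  fixes f :: "'i \<Rightarrow> 'a::field_char_0"
  shows "(\<And>i. i \<in> S \<Longrightarrow> algebraic_int (f i)) \<Longrightarrow> algebraic_int (prod f S)"
  by (induction S rule: infinite_finite_induct) (auto intro: algebraic_int_mult)

lemma algebraic_int_power: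
  fixes x :: "'a::field_char_0"
  shows "algebraic_int x \<Longrightarrow> algebraic_int (x ^ k)"
  by (induction k) (auto intro: algebraic_int_mult)

lemma algebraic_int_power2D:
  fixes x :: "'a::field_char_0"
  assumes "algebraic_int (x\<^sup>2)"
  shows "algebraic_int x"
proof (rule algebraic_int_root[OF assms])
  show "poly (Polynomial.monom 1 2) x = x\<^sup>2" by (simp add: poly_monom)
qed (auto simp: Polynomial.degree_monom_eq)

section \<open>Transfer between a field and its algebraic closure\<close>

lemma algebraic_int_to_acD:
  fixes x :: "'a::field_char_0"
  assumes "algebraic_int (to_ac x)"
  shows "algebraic_int x"
proof -
  obtain p where p: "poly (map_poly of_int p) (to_ac x) = 0" "Polynomial.lead_coeff p = 1"
    using assms unfolding algebraic_int_altdef_ipoly by blast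
  have "to_ac (poly (map_poly of_int p) x) = poly (map_poly of_int p) (to_ac x)"
    by (simp add: poly_altdef to_ac_sum)
  with p show ?thesis
    unfolding algebraic_int_altdef_ipoly by (metis to_ac_eq_0_iff)
qed

lemma algebraic_int_to_ac:
  fixes x :: "'a::field_char_0"
  assumes "algebraic_int x"
  shows "algebraic_int (to_ac x)"
proof -
  obtain p where p: "poly (map_poly of_int p) x = 0" "Polynomial.lead_coeff p = 1"
    using assms unfolding algebraic_int_altdef_ipoly by blast
  have "to_ac (poly (map_poly of_int p) x) = poly (map_poly of_int p) (to_ac x)"
    by (simp add: poly_altdef to_ac_sum)
  with p show ?thesis
    unfolding algebraic_int_altdef_ipoly by (metis to_ac_0)
qed

section \<open>Symmetric matrices with simple spectrum\<close>

lemma poly_at_mat_carrier [simp]: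
  "A \<in> carrier_mat n n \<Longrightarrow> poly_at_mat f A \<in> carrier_mat n n"
  by (simp add: poly_at_mat_def)

text \<open>Any upper bound \<open>N\<close> for the degree may serve as the range of summation, so
  that polynomials of different degrees can be compared term by term.\<close>

lemma poly_at_mat_index:
  assumes "A \<in> carrier_mat n n" "i < n" "j < n" "Polynomial.degree f \<le> N"
  shows "poly_at_mat f A $$ (i, j) = (\<Sum>k\<le>N. Polynomial.coeff f k * (A ^\<^sub>m k) $$ (i, j))"
  using assms
  by (auto simp: poly_at_mat_def intro!: sum.mono_neutral_left le_degree)

text \<open>Reduces integrality of a quadratic value at a polynomial in \<open>A\<close> to that of
  the values at powers of \<open>A\<close>, which \<open>Q^T Q\<close> and \<open>Y\<close>
  control.\<close>

lemma scalar_prod_poly_at_mat: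
  assumes A: "A \<in> carrier_mat n n" and w: "w \<in> carrier_vec n" and v: "v \<in> carrier_vec n"
  shows "w \<bullet> (poly_at_mat f A *\<^sub>v v) =
    (\<Sum>k\<le>Polynomial.degree f. Polynomial.coeff f k * (w \<bullet> ((A ^\<^sub>m k) *\<^sub>v v)))"
proof -
  let ?N = "Polynomial.degree f"
  have "w \<bullet> (poly_at_mat f A *\<^sub>v v) =
      (\<Sum>i<n. \<Sum>j<n. \<Sum>k\<le>?N. w $ i * (Polynomial.coeff f k * (A ^\<^sub>m k) $$ (i, j)) * v $ j)"
    using assms
    by (simp add: scalar_prod_def poly_at_mat_def sum_distrib_left sum_distrib_right lessThan_atLeast0 mult.assoc)
  also have "\<dots> = (\<Sum>k\<le>?N. \<Sum>i<n. \<Sum>j<n. w $ i * (Polynomial.coeff f k * (A ^\<^sub>m k) $$ (i, j)) * v $ j)"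
    by (simp only: sum.swap[of _ "{..?N}" "{..<n}"])
  also have "\<dots> = (\<Sum>k\<le>?N. Polynomial.coeff f k * (w \<bullet> ((A ^\<^sub>m k) *\<^sub>v v)))"
    using assms
    by (simp add: scalar_prod_def sum_distrib_left lessThan_atLeast0 ac_simps)
  finally show ?thesis .
qed

lemma poly_at_mat_mult_vec:
  assumes A: "A \<in> carrier_mat n n" and v: "v \<in> carrier_vec n" and i: "i < n"
  shows "(poly_at_mat f A *\<^sub>v v) $ i =
    (\<Sum>k\<le>Polynomial.degree f. Polynomial.coeff f k * ((A ^\<^sub>m k) *\<^sub>v v) $ i)"
proof -
  \<comment> \<open>A coordinate is the scalar product with a unit vector, which makes the claim a
    case of \<open>scalar_prod_poly_at_mat\<close>.\<close>
  have "unit_vec n i \<bullet> (B *\<^sub>v v) = (B *\<^sub>v v) $ i" if "B \<in> carrier_mat n n" for B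
    using that v i by (intro scalar_prod_left_unit[of _ n]) auto
  then show ?thesis
    using scalar_prod_poly_at_mat[OF A unit_vec_carrier[of n i] v, of f] A by simp
qed

lemma poly_at_mat_eigenvector:
  assumes A: "A \<in> carrier_mat n n" and ev: "eigenvector A v e"
  shows "poly_at_mat f A *\<^sub>v v = poly f e \<cdot>\<^sub>v v"
proof (rule eq_vecI)
  have v: "v \<in> carrier_vec n" using ev A by (simp add: eigenvector_def)
  fix i assume "i < dim_vec (poly f e \<cdot>\<^sub>v v)"
  then have i: "i < n" using v by simp
  show "(poly_at_mat f A *\<^sub>v v) $ i = (poly f e \<cdot>\<^sub>v v) $ i"
    unfolding poly_at_mat_mult_vec[OF A v i] eigenvector_pow[OF A ev]
    using v i by (simp add: poly_altdef sum_distrib_right mult.assoc)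
qed (use A ev in \<open>auto simp: eigenvector_def poly_at_mat_def\<close>)

lemma mult_mat_vec_index:
  assumes "B \<in> carrier_mat n n" "v \<in> carrier_vec n" "i < n"
  shows "(B *\<^sub>v v) $ i = (\<Sum>j<n. B $$ (i, j) * v $ j)"
  using assms by (simp add: scalar_prod_def lessThan_atLeast0)

lemma poly_at_mat_sum_mult_vec:
  assumes A: "A \<in> carrier_mat n n" and v: "v \<in> carrier_vec n" and i: "i < n" and S: "finite S"
  shows "(poly_at_mat (sum f S) A *\<^sub>v v) $ i = (\<Sum>s\<in>S. (poly_at_mat (f s) A *\<^sub>v v) $ i)"
proof -
  \<comment> \<open>A common degree bound lets all summands range over the same exponents; the
    inserted 0 covers empty \<open>S\<close>.\<close>
  define N where "N = Max (insert 0 (Polynomial.degree ` f ` S))"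
  have fN: "Polynomial.degree (f s) \<le> N" if "s \<in> S" for s
    unfolding N_def using S that by (intro Max_ge) auto
  have sN: "Polynomial.degree (sum f S) \<le> N"
    by (rule degree_sum_le[OF S fN])
  have "(poly_at_mat (sum f S) A *\<^sub>v v) $ i =
      (\<Sum>j<n. (\<Sum>k\<le>N. Polynomial.coeff (sum f S) k * (A ^\<^sub>m k) $$ (i, j)) * v $ j)"
    unfolding mult_mat_vec_index[OF poly_at_mat_carrier[OF A] v i]
    by (intro sum.cong refl) (simp add: poly_at_mat_index[OF A i _ sN])
  also have "\<dots> = (\<Sum>s\<in>S. \<Sum>j<n. (\<Sum>k\<le>N. Polynomial.coeff (f s) k * (A ^\<^sub>m k) $$ (i, j)) * v $ j)"
    by (simp add: coeff_sum sum_distrib_left sum_distrib_right sum.swap[of _ S])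
  also have "\<dots> = (\<Sum>s\<in>S. (poly_at_mat (f s) A *\<^sub>v v) $ i)"
    unfolding mult_mat_vec_index[OF poly_at_mat_carrier[OF A] v i]
    by (intro sum.cong refl) (simp add: poly_at_mat_index[OF A i _ fN])
  finally show ?thesis .
qed

lemma poly_at_mat_hom:
  fixes X :: "int mat"
  assumes X: "X \<in> carrier_mat n n"
  shows "map_mat of_int (poly_at_mat f X) =
    (poly_at_mat (map_poly of_int f) (map_mat of_int X) :: 'a::{comm_ring_1,ring_char_0} mat)"
proof (rule eq_matI)
  fix i j assume "i < dim_row (poly_at_mat (map_poly of_int f) (map_mat of_int X :: 'a mat))"
    "j < dim_col (poly_at_mat (map_poly of_int f) (map_mat of_int X :: 'a mat))"
  then have ij: "i < n" "j < n" using X by (auto simp: poly_at_mat_def)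
  have X': "(map_mat of_int X :: 'a mat) \<in> carrier_mat n n" using X by simp
  have "(map_mat of_int X ^\<^sub>m k :: 'a mat) $$ (i, j) = of_int ((X ^\<^sub>m k) $$ (i, j))" for k
    using X ij by (simp flip: of_int_hom.mat_hom_pow[OF X])
  then show "map_mat of_int (poly_at_mat f X) $$ (i, j) = (poly_at_mat (map_poly of_int f) (map_mat of_int X) :: 'a mat) $$ (i, j)"
    using X ij by (simp add: poly_at_mat_def)
qed (use X in \<open>auto simp: poly_at_mat_def\<close>)

lemma scalar_prod_symmetric_mat:
  fixes A :: "'a::comm_ring_1 mat"
  assumes "A \<in> carrier_mat n n" "transpose_mat A = A" "v \<in> carrier_vec n" "w \<in> carrier_vec n"
  shows "(A *\<^sub>v v) \<bullet> w = v \<bullet> (A *\<^sub>v w)"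
  using transpose_vec_mult_scalar[of A n n w v] assms by simp

section \<open>Symmetric matrices with distinct eigenvalues over an arbitrary field\<close>

locale simple_symmetric_spectrum =
  fixes n :: nat and A :: "'a::field mat" and e :: "nat \<Rightarrow> 'a" and v :: "nat \<Rightarrow> 'a vec"
  assumes A: "A \<in> carrier_mat n n"
    and sym: "transpose_mat A = A"
    and inj: "inj_on e {..<n}"
    and ev: "k < n \<Longrightarrow> eigenvector A (v k) (e k)"
begin

lemma v_carrier [simp]: "k < n \<Longrightarrow> v k \<in> carrier_vec n"
  and v_dim [simp]: "k < n \<Longrightarrow> dim_vec (v k) = n"
  and v_nonzero: "k < n \<Longrightarrow> v k \<noteq> 0\<^sub>v n"
  and A_mult_v: "k < n \<Longrightarrow> A *\<^sub>v v k = e k \<cdot>\<^sub>v v k"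
  using ev[of k] A by (auto simp: eigenvector_def)

lemma orthogonal:
  assumes "k < n" "l < n" "k \<noteq> l"
  shows "v k \<bullet> v l = 0"
proof -
  have "e k * (v k \<bullet> v l) = (A *\<^sub>v v k) \<bullet> v l" using assms by (simp add: A_mult_v)
  also have "\<dots> = v k \<bullet> (A *\<^sub>v v l)" using assms A sym by (simp add: scalar_prod_symmetric_mat)
  also have "\<dots> = e l * (v k \<bullet> v l)" using assms by (simp add: A_mult_v)
  finally show ?thesis using inj assms by (auto simp: inj_on_def)
qed

text \<open>The characteristic polynomial of \<open>A\<close> without the factor for
  \<open>e k\<close>, an unnormalised Lagrange basis polynomial at the eigenvalues; at
  \<open>A\<close> it gives a multiple of the projection onto the line of
  \<open>v k\<close>.\<close>

definition cofactor_poly :: "nat \<Rightarrow> 'a poly" where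
  "cofactor_poly k = (\<Prod>l\<in>{..<n} - {k}. [:- e l, 1:])"

lemma poly_cofactor_poly_eq_0_iff:
  assumes "k < n" "l < n"
  shows "poly (cofactor_poly k) (e l) = 0 \<longleftrightarrow> l \<noteq> k"
  using assms inj by (auto simp: cofactor_poly_def poly_prod inj_on_def)

text \<open>The eigenvectors form a basis, and a vector orthogonal to a basis is zero. Otherwise the
  matrix \<open>V\<close> with the eigenvectors as columns would be singular, and its columns would
  satisfy a nontrivial linear relation.\<close>

lemma vec_eq_0I:
  assumes w: "w \<in> carrier_vec n" and w0: "\<And>k. k < n \<Longrightarrow> v k \<bullet> w = 0"
  shows "w = 0\<^sub>v n"
proof (rule ccontr)
  assume wn: "w \<noteq> 0\<^sub>v n"
  define V where "V = mat n n (\<lambda>(i, k). v k $ i)"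
  have V: "V \<in> carrier_mat n n" by (simp add: V_def)
  have col: "col V l = v l" if "l < n" for l
    using that by (auto simp: V_def)
  have "transpose_mat V *\<^sub>v w = 0\<^sub>v n"
    using V by (intro eq_vecI) (auto simp: col w0)
  then have "det (transpose_mat V) = 0"
    using det_0_iff_vec_prod_zero_field[of "transpose_mat V" n] V w wn by auto
  then have "det V = 0" using V by (simp add: det_transpose)
  then obtain c where c: "c \<in> carrier_vec n" "c \<noteq> 0\<^sub>v n" "V *\<^sub>v c = 0\<^sub>v n"
    using det_0_iff_vec_prod_zero_field[OF V] by blast
  obtain k where k: "k < n" "c $ k \<noteq> 0"
    using c(1,2) by (metis carrier_vecD eq_vecI index_zero_vec)
  obtain i where i: "i < n" "v k $ i \<noteq> 0"
    using v_nonzero[OF k(1)] k(1) by (metis v_dim eq_vecI index_zero_vec)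
  \<comment> \<open>This matrix annihilates every \<open>v l\<close> with
    \<open>l \<noteq> k\<close>, so applied to the relation given by \<open>c\<close> it isolates
    the term with the nonzero coefficient \<open>c $ k\<close>.\<close>
  let ?R = "poly_at_mat (cofactor_poly k) A"
  have R: "?R \<in> carrier_mat n n" using A by simp
  have RV: "(?R * V) $$ (i, l) = poly (cofactor_poly k) (e l) * v l $ i" if l: "l < n" for l
  proof -
    have "(?R * V) $$ (i, l) = (?R *\<^sub>v v l) $ i" using R V l i by (simp add: col)
    then show ?thesis using l i by (simp add: poly_at_mat_eigenvector[OF A ev])
  qed
  have "0 = ((?R * V) *\<^sub>v c) $ i"
    using R V c i by (simp add: assoc_mult_mat_vec[OF R V c(1)])
  also have "\<dots> = (\<Sum>l<n. (?R * V) $$ (i, l) * c $ l)"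
    by (rule mult_mat_vec_index[OF mult_carrier_mat[OF R V] c(1) i(1)])
  also have "\<dots> = (\<Sum>l<n. poly (cofactor_poly k) (e l) * v l $ i * c $ l)"
    by (intro sum.cong refl) (simp add: RV)
  also have "\<dots> = (\<Sum>l\<in>{k}. poly (cofactor_poly k) (e l) * v l $ i * c $ l)"
    using k(1) by (intro sum.mono_neutral_right) (auto simp: poly_cofactor_poly_eq_0_iff)
  finally show False using k i by (simp add: poly_cofactor_poly_eq_0_iff)
qed

text \<open>Over a general field an eigenvector of a symmetric matrix may be isotropic. Here it
  would be orthogonal to all eigenvectors, itself included, hence zero.\<close>

lemma v_anisotropic:
  assumes k: "k < n"
  shows "v k \<bullet> v k \<noteq> 0"
proof
  assume "v k \<bullet> v k = 0"
  then have "v l \<bullet> v k = 0" if "l < n" for l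
    using orthogonal[of l k] that k by (cases "l = k") auto
  then show False using vec_eq_0I[of "v k"] v_nonzero k by auto
qed

text \<open>The matrix is \<open>c\<close> times the product of \<open>v k\<close> with its
  transpose. Each row, minus the predicted multiple of \<open>v k\<close>, is orthogonal to all
  eigenvectors, since \<open>v l \<bullet> row ?R i\<close> is the \<open>i\<close>-th coordinate of
  \<open>?R\<close> applied to \<open>v l\<close>.\<close>

lemma poly_at_mat_cofactor_poly:
  assumes k: "k < n"
  obtains c where "\<And>i j. i < n \<Longrightarrow> j < n \<Longrightarrow>
    poly_at_mat (cofactor_poly k) A $$ (i, j) = c * v k $ i * v k $ j"
proof
  fix i j assume i: "i < n" and j: "j < n"
  let ?R = "poly_at_mat (cofactor_poly k) A"
  \<comment> \<open>The constant is forced by the action on \<open>v k\<close>; its denominator is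
    nonzero by \<open>v_anisotropic\<close>.\<close>
  define c where "c = poly (cofactor_poly k) (e k) / (v k \<bullet> v k)"
  define w where "w = row ?R i - (c * v k $ i) \<cdot>\<^sub>v v k"
  have R: "?R \<in> carrier_mat n n" using A by simp
  have rowR: "row ?R i \<in> carrier_vec n" using R i by auto
  have w: "w \<in> carrier_vec n" using R i k by (simp add: w_def)
  have "v l \<bullet> w = 0" if l: "l < n" for l
  proof -
    have "v l \<bullet> row ?R i = (?R *\<^sub>v v l) $ i"
      using R i l rowR by (simp add: comm_scalar_prod[of _ n])
    also have "\<dots> = poly (cofactor_poly k) (e l) * v l $ i"
      using l i by (simp add: poly_at_mat_eigenvector[OF A ev])
    finally have 1: "v l \<bullet> row ?R i = poly (cofactor_poly k) (e l) * v l $ i" .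
    have "v l \<bullet> w = v l \<bullet> row ?R i - (c * v k $ i) * (v l \<bullet> v k)"
      unfolding w_def using l k rowR by (simp add: scalar_prod_minus_distrib[of _ n])
    then show ?thesis
    proof (cases "l = k")
      case True
      then show ?thesis using \<open>v l \<bullet> w = _\<close> 1 v_anisotropic[OF k] by (simp add: c_def)
    next
      case False
      then show ?thesis using \<open>v l \<bullet> w = _\<close> 1 orthogonal[OF l k] poly_cofactor_poly_eq_0_iff[OF k l] by simp
    qed
  qed
  then have "w = 0\<^sub>v n" by (rule vec_eq_0I[OF w])
  then have "w $ j = 0" using j by simp
  then show "?R $$ (i, j) = poly (cofactor_poly k) (e k) / (v k \<bullet> v k) * v k $ i * v k $ j"
    using R i j k by (simp add: w_def c_def)
qed

text \<open>By rank one, both sides are the square of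
  \<open>c * v k $ i * (v k \<bullet> q)\<close>. A coordinate linear in \<open>q\<close> is thus
  controlled by a quadratic value, the kind of data that the hypotheses on \<open>Q\<close>
  provide.\<close>

lemma poly_at_mat_cofactor_poly_sq:
  assumes k: "k < n" and q: "q \<in> carrier_vec n" and i: "i < n"
  defines "R \<equiv> poly_at_mat (cofactor_poly k) A"
  shows "((R *\<^sub>v q) $ i)\<^sup>2 = R $$ (i, i) * (q \<bullet> (R *\<^sub>v q))"
proof -
  obtain c where c: "\<And>i j. i < n \<Longrightarrow> j < n \<Longrightarrow> R $$ (i, j) = c * v k $ i * v k $ j"
    using poly_at_mat_cofactor_poly[OF k] unfolding R_def by blast
  have R: "R \<in> carrier_mat n n" using A by (simp add: R_def)
  have Rq: "(R *\<^sub>v q) $ j = c * v k $ j * (v k \<bullet> q)" if "j < n" for j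
    using R q that k by (simp add: scalar_prod_def c sum_distrib_left mult.assoc)
  have "q \<bullet> (R *\<^sub>v q) = (\<Sum>j\<in>{0..<n}. q $ j * (c * v k $ j * (v k \<bullet> q)))"
    using R q by (simp add: scalar_prod_def[of q] Rq del: index_mult_mat_vec)
  also have "\<dots> = c * (v k \<bullet> q) * (v k \<bullet> q)"
    using q k by (simp add: scalar_prod_def[of "v k"] sum_distrib_left sum_distrib_right ac_simps)
  finally show ?thesis using i by (simp add: Rq c power2_eq_square del: index_mult_mat_vec)
qed

end

section \<open>Integrality of the discriminant times squared entries\<close>

lemma algebraic_int_det:
  fixes M :: "'a::field_char_0 mat"
  assumes M: "M \<in> carrier_mat n n" and int: "\<And>i j. i < n \<Longrightarrow> j < n \<Longrightarrow> algebraic_int (M $$ (i, j))"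
  shows "algebraic_int (det M)"
  unfolding det_def'[OF M]
proof (intro algebraic_int_sum algebraic_int_mult algebraic_int_prod)
  fix p assume "p \<in> {p. p permutes {0..<n}}"
  then have p: "p permutes {0..<n}" by simp
  show "algebraic_int (signof p :: 'a)" by (rule sign_cases[of p]) auto
  fix i assume "i \<in> {0..<n}"
  then show "algebraic_int (M $$ (i, p i))" using permutes_in_image[OF p, of i] by (auto intro: int)
qed

text \<open>Cramer's rule used twice: replacing column \<open>i\<close> of a matrix by its product
  with \<open>q\<close> multiplies the determinant by \<open>q $ i\<close>. This is done in
  \<open>M\<close>, then in the transpose \<open>N\<close> of the result, and only integral entries
  remain.\<close>

lemma algebraic_int_det_mult_sq:
  fixes M :: "'a::field_char_0 mat"
  assumes M: "M \<in> carrier_mat n n" and sym: "transpose_mat M = M"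
    and int: "\<And>i j. i < n \<Longrightarrow> j < n \<Longrightarrow> algebraic_int (M $$ (i, j))"
    and q: "q \<in> carrier_vec n"
    and Mq: "\<And>i. i < n \<Longrightarrow> algebraic_int ((M *\<^sub>v q) $ i)"
    and qMq: "algebraic_int (q \<bullet> (M *\<^sub>v q))"
    and i: "i < n"
  shows "algebraic_int (det M * (q $ i)\<^sup>2)"
proof -
  define N where "N = transpose_mat (replace_col M (M *\<^sub>v q) i)"
  have rc: "replace_col M (M *\<^sub>v q) i \<in> carrier_mat n n"
    using M by (simp add: replace_col_def)
  have N: "N \<in> carrier_mat n n" using rc by (simp add: N_def)
  have Mqc: "M *\<^sub>v q \<in> carrier_vec n" using M q by simp
  have rowN: "row N a = (if a = i then M *\<^sub>v q else col M a)" if "a < n" for a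
    using that M q by (auto simp: N_def replace_col_def)
  have colM: "col M a = row M a" if "a < n" for a
    using that M sym by (metis carrier_matD(1,2) row_transpose)
  \<comment> \<open>By symmetry of \<open>M\<close>, the matrix \<open>N\<close> is \<open>M\<close>
    with row \<open>i\<close> replaced by \<open>M q\<close>, so its product with \<open>q\<close>
    consists of coordinates of \<open>M q\<close> and the quadratic value.\<close>
  have Nq: "(N *\<^sub>v q) $ a = (if a = i then q \<bullet> (M *\<^sub>v q) else (M *\<^sub>v q) $ a)" if "a < n" for a
    using that N M q Mqc by (simp add: rowN colM comm_scalar_prod[of q n])
  have Nint: "algebraic_int (N $$ (a, b))" if "a < n" "b < n" for a b
    using that M Mq int by (auto simp: N_def replace_col_def simp del: index_mult_mat_vec)
  define N2 where "N2 = replace_col N (N *\<^sub>v q) i"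
  have N2: "N2 \<in> carrier_mat n n" using N by (simp add: N2_def replace_col_def)
  have "algebraic_int (det N2)"
  proof (rule algebraic_int_det[OF N2])
    fix a b assume "a < n" "b < n"
    then show "algebraic_int (N2 $$ (a, b))"
      using N Nint Mq qMq by (auto simp: N2_def replace_col_def Nq simp del: index_mult_mat_vec)
  qed
  also have "det N2 = q $ i * det N"
    unfolding N2_def by (rule cramer_lemma_mat[OF N q i])
  also have "det N = q $ i * det M"
    unfolding N_def det_transpose[OF rc] by (rule cramer_lemma_mat[OF M q i])
  finally show ?thesis by (simp add: power2_eq_square ac_simps)
qed

lemma algebraic_int_pow_mat_index:
  fixes A :: "'a::field_char_0 mat"
  assumes A: "A \<in> carrier_mat n n" and int: "\<And>i j. i < n \<Longrightarrow> j < n \<Longrightarrow> algebraic_int (A $$ (i, j))"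
    and ij: "i < n" "j < n"
  shows "algebraic_int ((A ^\<^sub>m k) $$ (i, j))"
  using ij
proof (induction k arbitrary: i j)
  case 0
  then show ?case using A by simp
next
  case (Suc k)
  have "A ^\<^sub>m k \<in> carrier_mat n n" using A by simp
  then have "(A ^\<^sub>m Suc k) $$ (i, j) = (\<Sum>l\<in>{0..<n}. (A ^\<^sub>m k) $$ (i, l) * A $$ (l, j))"
    using A Suc.prems by (simp add: scalar_prod_def)
  then show ?case
    using Suc int by (auto intro!: algebraic_int_sum algebraic_int_mult)
qed

section \<open>Factorisation and derivative of the characteristic polynomial\<close>

lemma algebraic_int_coeff_prod_linear:
  fixes e :: "nat \<Rightarrow> 'a::field_char_0"
  assumes "finite S" "\<And>l. l \<in> S \<Longrightarrow> algebraic_int (e l)"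
  shows "algebraic_int (Polynomial.coeff (\<Prod>l\<in>S. [:- e l, 1:]) k)"
  using assms
proof (induction S arbitrary: k rule: finite_induct)
  case empty
  then show ?case by (cases k) auto
next
  case (insert l S)
  have "(\<Prod>l\<in>insert l S. [:- e l, 1:]) = Polynomial.smult (- e l) (\<Prod>l\<in>S. [:- e l, 1:]) + pCons 0 (\<Prod>l\<in>S. [:- e l, 1:])"
    using insert.hyps by (simp add: mult_pCons_left)
  then show ?case
    using insert by (cases k) (auto intro!: algebraic_int_add algebraic_int_diff algebraic_int_mult)
qed

lemma char_poly_linear_factors:
  fixes A :: "'a::alg_closed_field mat"
  assumes A: "A \<in> carrier_mat n n"
  obtains e where "char_poly A = (\<Prod>k<n. [:- e k, 1:])"
proof -
  have deg: "Polynomial.degree (char_poly A) = n" "Polynomial.coeff (char_poly A) n = 1"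
    using degree_monic_char_poly[OF A] by auto
  then have "char_poly A \<noteq> 0" by auto
  then obtain B where B: "size B = n" "char_poly A = (\<Prod>x\<in>#B. [:- x, 1:])"
    using alg_closed_imp_factorization[of "char_poly A"] deg by auto
  obtain xs where xs: "mset xs = B" using ex_mset by blast
  have "char_poly A = (\<Prod>x\<leftarrow>xs. [:- x, 1:])"
    unfolding B(2) xs[symmetric] by (simp flip: prod_mset_prod_list)
  also have "\<dots> = (\<Prod>k<n. [:- (xs ! k), 1:])"
    using B(1) xs by (auto simp: prod.list_conv_set_nth lessThan_atLeast0)
  finally show thesis by (rule that)
qed

lemma pderiv_prod_linear:
  fixes e :: "nat \<Rightarrow> 'a::idom"
  shows "pderiv (\<Prod>k<n. [:- e k, 1:]) = (\<Sum>k<n. \<Prod>l\<in>{..<n} - {k}. [:- e l, 1:])"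
  by (simp add: pderiv_prod pderiv_pCons)

text \<open>The derivative of the characteristic polynomial is the sum of the
  \<open>cofactor_poly k\<close>. For each of them the square of the coordinate is integral, and a
  square root of an integral element is integral.\<close>

lemma algebraic_int_pderiv_char_poly_mult_vec:
  fixes A :: "'a::{alg_closed_field,field_char_0} mat"
  assumes A: "A \<in> carrier_mat n n" and sym: "transpose_mat A = A"
    and int: "\<And>i j. i < n \<Longrightarrow> j < n \<Longrightarrow> algebraic_int (A $$ (i, j))"
    and roots: "\<And>x. poly (char_poly A) x = 0 \<Longrightarrow> algebraic_int x"
    and det: "det (poly_at_mat (pderiv (char_poly A)) A) \<noteq> 0"
    and q: "q \<in> carrier_vec n" and qAq: "\<And>k. algebraic_int (q \<bullet> ((A ^\<^sub>m k) *\<^sub>v q))"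
    and i: "i < n"
  shows "algebraic_int ((poly_at_mat (pderiv (char_poly A)) A *\<^sub>v q) $ i)"
proof -
  let ?M = "poly_at_mat (pderiv (char_poly A)) A"
  obtain e where e: "char_poly A = (\<Prod>k<n. [:- e k, 1:])"
    using char_poly_linear_factors[OF A] .
  have root: "poly (char_poly A) (e k) = 0" if "k < n" for k
    using that unfolding e by (auto simp: poly_prod)
  have "\<exists>v. eigenvector A v (e k)" if "k < n" for k
    using root[OF that] eigenvalue_root_char_poly[OF A] unfolding eigenvalue_def by blast
  then obtain v where v: "\<And>k. k < n \<Longrightarrow> eigenvector A (v k) (e k)" by metis
  \<comment> \<open>A root shared with the derivative would put \<open>v k\<close> into the kernel
    of the invertible matrix \<open>?M\<close>.\<close>
  have simple: "poly (pderiv (char_poly A)) (e k) \<noteq> 0" if k: "k < n" for k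
  proof
    assume "poly (pderiv (char_poly A)) (e k) = 0"
    then have "?M *\<^sub>v v k = 0\<^sub>v n"
      using poly_at_mat_eigenvector[OF A v[OF k], of "pderiv (char_poly A)"] v[OF k] A
      by (auto simp: eigenvector_def)
    moreover have "v k \<in> carrier_vec n" "v k \<noteq> 0\<^sub>v n"
      using v[OF k] A by (auto simp: eigenvector_def)
    ultimately show False
      using det det_0_iff_vec_prod_zero_field[of ?M n] A by auto
  qed
  \<comment> \<open>If two indices share a root, every product missing one factor still vanishes
    there, hence so does the derivative.\<close>
  have "inj_on e {..<n}"
  proof (rule inj_onI, rule ccontr)
    fix k l assume kl: "k \<in> {..<n}" "l \<in> {..<n}" "e k = e l" "k \<noteq> l"
    have "poly (\<Prod>m\<in>{..<n} - {j}. [:- e m, 1:]) (e k) = 0" if "j < n" for j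
      using kl by (cases "j = k") (auto simp: poly_prod intro: bexI[of _ k] bexI[of _ l])
    then have "poly (pderiv (char_poly A)) (e k) = 0"
      unfolding e pderiv_prod_linear by (simp add: poly_sum)
    then show False using simple kl by simp
  qed
  then interpret simple_symmetric_spectrum n A e v
    using A sym v by unfold_locales auto
  have coeff: "algebraic_int (Polynomial.coeff (cofactor_poly k) m)" for k m
    unfolding cofactor_poly_def
    by (rule algebraic_int_coeff_prod_linear) (auto intro: roots root)
  have "algebraic_int ((poly_at_mat (cofactor_poly k) A *\<^sub>v q) $ i)" if k: "k < n" for k
  proof (rule algebraic_int_power2D)
    have "algebraic_int (poly_at_mat (cofactor_poly k) A $$ (i, i))"
      unfolding poly_at_mat_index[OF A i i order_refl]
      by (intro algebraic_int_sum algebraic_int_mult coeff algebraic_int_pow_mat_index[OF A int i i])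
    moreover have "algebraic_int (q \<bullet> (poly_at_mat (cofactor_poly k) A *\<^sub>v q))"
      unfolding scalar_prod_poly_at_mat[OF A q q]
      by (intro algebraic_int_sum algebraic_int_mult coeff qAq)
    ultimately show "algebraic_int (((poly_at_mat (cofactor_poly k) A *\<^sub>v q) $ i)\<^sup>2)"
      unfolding poly_at_mat_cofactor_poly_sq[OF k q i] by (rule algebraic_int_mult)
  qed
  moreover have "pderiv (char_poly A) = (\<Sum>k<n. cofactor_poly k)"
    unfolding e pderiv_prod_linear cofactor_poly_def ..
  ultimately show ?thesis
    using poly_at_mat_sum_mult_vec[OF A q i, of "{..<n}" cofactor_poly]
    by (auto intro!: algebraic_int_sum simp del: index_mult_mat_vec)
qed

lemma pow_mat_intertwine:
  fixes A :: "'a::comm_ring_1 mat"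
  assumes "A \<in> carrier_mat n n" "Q \<in> carrier_mat n n" "Y \<in> carrier_mat n n" "A * Q = Q * Y"
  shows "A ^\<^sub>m k * Q = Q * Y ^\<^sub>m k"
proof (induction k)
  case (Suc k)
  have Ak: "A ^\<^sub>m k \<in> carrier_mat n n" and Yk: "Y ^\<^sub>m k \<in> carrier_mat n n" using assms by auto
  have "A ^\<^sub>m Suc k * Q = A ^\<^sub>m k * (A * Q)" using assms Ak by (simp add: assoc_mult_mat[of _ n n _ n _ n])
  also have "\<dots> = (A ^\<^sub>m k * Q) * Y" using assms Ak by (simp add: assoc_mult_mat[of _ n n _ n _ n])
  also have "\<dots> = Q * Y ^\<^sub>m Suc k" using assms Yk by (simp add: Suc assoc_mult_mat[of _ n n _ n _ n])
  finally show ?case .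
qed (use assms in auto)

lemma transpose_pow_mat:
  fixes A :: "'a::comm_ring_1 mat"
  assumes A: "A \<in> carrier_mat n n"
  shows "transpose_mat (A ^\<^sub>m k) = transpose_mat A ^\<^sub>m k"
proof (induction k)
  case (Suc k)
  have "transpose_mat (A ^\<^sub>m Suc k) = transpose_mat A * transpose_mat A ^\<^sub>m k"
    using A Suc by (simp add: transpose_mult[of _ n n _ n])
  \<comment> \<open>Intertwining with all three matrices equal says that a matrix commutes with its
    powers.\<close>
  also have "\<dots> = transpose_mat A ^\<^sub>m Suc k"
    using pow_mat_intertwine[of "transpose_mat A" n "transpose_mat A" "transpose_mat A" k] A by simp
  finally show ?case .
qed (use A in auto)

lemma transpose_poly_at_mat:
  fixes A :: "'a::comm_ring_1 mat"
  assumes A: "A \<in> carrier_mat n n" and sym: "transpose_mat A = A"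
  shows "transpose_mat (poly_at_mat f A) = poly_at_mat f A"
proof (rule eq_matI)
  fix i j assume "i < dim_row (poly_at_mat f A)" "j < dim_col (poly_at_mat f A)"
  then have ij: "i < n" "j < n" using A by (auto simp: poly_at_mat_def)
  have "(A ^\<^sub>m k) $$ (i, j) = (A ^\<^sub>m k) $$ (j, i)" for k
    using ij A transpose_pow_mat[OF A, of k] sym
    by (metis carrier_matD index_transpose_mat(1) pow_carrier_mat)
  then show "transpose_mat (poly_at_mat f A) $$ (i, j) = poly_at_mat f A $$ (i, j)"
    using ij A by (simp add: poly_at_mat_def)
qed (use A in \<open>auto simp: poly_at_mat_def\<close>)

lemma integral_mat_iff:
  "integral_mat B \<longleftrightarrow> (\<forall>i<dim_row B. \<forall>j<dim_col B. algebraic_int (B $$ (i, j)))"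
  unfolding integral_mat_def ring_of_integers_def by (fastforce simp: elements_mat_def)

text \<open>The entries are embedded into the algebraic closure, where eigenvectors exist, and
  integrality descends at the end. For a column \<open>u\<close> of \<open>Q\<close>, the value of
  \<open>u \<bullet> X^k u\<close> is a diagonal entry of \<open>Q^T X^k Q = (Q^T Q) Y^k\<close>,
  hence integral.\<close>

lemma algebraic_int_discriminant_mult_sq:
  fixes X :: "int mat" and Q Y :: "'k::field_char_0 mat"
  assumes X: "X \<in> carrier_mat n n" and sym: "transpose_mat X = X"
    and Q: "Q \<in> carrier_mat n n" and QQ: "integral_mat (transpose_mat Q * Q)"
    and Y: "Y \<in> carrier_mat n n" and Yint: "integral_mat Y"
    and XQ: "map_mat of_int X * Q = Q * Y"
    and nz: "mat_discriminant X \<noteq> 0"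
    and ij: "i < n" "j < n"
  shows "algebraic_int (of_int (mat_discriminant X) * (Q $$ (i, j))\<^sup>2)"
proof -
  interpret to_ac: inj_comm_ring_hom "to_ac :: 'k \<Rightarrow> 'k alg_closure"
    by unfold_locales auto
  define AK :: "'k mat" where "AK = map_mat of_int X"
  define A :: "'k alg_closure mat" where "A = map_mat of_int X"
  define M where "M = poly_at_mat (pderiv (char_poly A)) A"
  define q where "q = map_vec to_ac (col Q j)"
  have AK: "AK \<in> carrier_mat n n" and A: "A \<in> carrier_mat n n"
    using X by (auto simp: AK_def A_def)
  have A_AK: "A = map_mat to_ac AK" unfolding A_def AK_def by (rule eq_matI) auto
  have q: "q \<in> carrier_vec n" using Q by (auto simp: q_def)
  have symA: "transpose_mat A = A" using sym by (simp add: A_def map_mat_transpose)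
  have cp: "char_poly A = map_poly of_int (char_poly X)"
    unfolding A_def by (rule of_int_hom.char_poly_hom[OF X])
  have M_eq: "M = map_mat of_int (poly_at_mat (pderiv (char_poly X)) X)"
    unfolding M_def poly_at_mat_hom[OF X] cp A_def[symmetric] of_int_hom.map_poly_pderiv ..
  have M: "M \<in> carrier_mat n n" using A by (simp add: M_def)
  have detM: "det M = of_int (mat_discriminant X)"
    unfolding M_eq of_int_hom.hom_det mat_discriminant_def ..
  have qAq: "algebraic_int (q \<bullet> ((A ^\<^sub>m k) *\<^sub>v q))" for k
  proof -
    have Ak: "A ^\<^sub>m k = map_mat to_ac (AK ^\<^sub>m k)"
      unfolding to_ac.mat_hom_pow[OF AK] A_AK ..
    have AKk: "AK ^\<^sub>m k \<in> carrier_mat n n" using AK by simp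
    have c: "col Q j \<in> carrier_vec n" using Q by auto
    have "q \<bullet> ((A ^\<^sub>m k) *\<^sub>v q) = to_ac (col Q j \<bullet> ((AK ^\<^sub>m k) *\<^sub>v col Q j))"
      unfolding q_def Ak to_ac.mult_mat_vec_hom[OF AKk c, symmetric]
      using AKk Q AK carrier_matD(1)[OF AK] by (simp add: scalar_prod_def to_ac_sum)
    also have "col Q j \<bullet> ((AK ^\<^sub>m k) *\<^sub>v col Q j) = (transpose_mat Q * (AK ^\<^sub>m k * Q)) $$ (j, j)"
      using Q AKk ij carrier_matD(1)[OF AK] by (simp add: mult_mat_vec_def)
    also have "transpose_mat Q * (AK ^\<^sub>m k * Q) = (transpose_mat Q * Q) * Y ^\<^sub>m k"
      using pow_mat_intertwine[OF AK Q Y] XQ Q Y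
      by (simp add: AK_def assoc_mult_mat[of _ n n _ n _ n])
    finally have "q \<bullet> ((A ^\<^sub>m k) *\<^sub>v q) = to_ac (((transpose_mat Q * Q) * Y ^\<^sub>m k) $$ (j, j))" .
    moreover have "algebraic_int (((transpose_mat Q * Q) * Y ^\<^sub>m k) $$ (j, j))"
    proof -
      have Yk: "Y ^\<^sub>m k \<in> carrier_mat n n" and QQc: "transpose_mat Q * Q \<in> carrier_mat n n"
        using Y Q by auto
      have mult_diag: "(B * C) $$ (j, j) = (\<Sum>l\<in>{0..<n}. B $$ (j, l) * C $$ (l, j))"
        if "B \<in> carrier_mat n n" "C \<in> carrier_mat n n" for B C :: "'k mat"
        using that ij by (simp add: scalar_prod_def)
      have "((transpose_mat Q * Q) * Y ^\<^sub>m k) $$ (j, j) =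
          (\<Sum>l\<in>{0..<n}. (transpose_mat Q * Q) $$ (j, l) * (Y ^\<^sub>m k) $$ (l, j))"
        by (rule mult_diag[OF QQc Yk])
      moreover have "algebraic_int ((transpose_mat Q * Q) $$ (j, l))" if "l < n" for l
        using QQ Q ij that unfolding integral_mat_iff by auto
      moreover have "algebraic_int ((Y ^\<^sub>m k) $$ (l, j))" if "l < n" for l
        using Yint Y ij that by (intro algebraic_int_pow_mat_index[OF Y]) (auto simp: integral_mat_iff)
      ultimately show ?thesis
        by (auto intro!: algebraic_int_sum algebraic_int_mult simp del: index_mult_mat)
    qed
    ultimately show ?thesis by (simp add: algebraic_int_to_ac del: index_mult_mat)
  qed
  have roots: "algebraic_int x" if "poly (char_poly A) x = 0" for x
    using algebraic_int_eigenvalue[OF X, of x] that A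
    by (simp add: A_def eigenvalue_root_char_poly[of _ n])
  have Mq: "algebraic_int ((M *\<^sub>v q) $ a)" if "a < n" for a
    unfolding M_def
  proof (rule algebraic_int_pderiv_char_poly_mult_vec[OF A symA _ roots _ q qAq that])
    show "det (poly_at_mat (pderiv (char_poly A)) A) \<noteq> 0"
      using detM nz by (simp add: M_def)
  qed (use X in \<open>auto simp: A_def\<close>)
  have coeffM: "algebraic_int (Polynomial.coeff (pderiv (char_poly A)) k)" for k
    unfolding cp of_int_hom.map_poly_pderiv[symmetric] by simp
  have qMq: "algebraic_int (q \<bullet> (M *\<^sub>v q))"
    unfolding M_def scalar_prod_poly_at_mat[OF A q q]
    by (intro algebraic_int_sum algebraic_int_mult qAq coeffM)
  have Mint: "algebraic_int (M $$ (a, b))" if "a < n" "b < n" for a b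
    using that M unfolding M_eq by auto
  have "algebraic_int (det M * (q $ i)\<^sup>2)"
    using algebraic_int_det_mult_sq[OF M _ Mint q Mq qMq ij(1)] transpose_poly_at_mat[OF A symA]
    by (simp add: M_def)
  also have "det M * (q $ i)\<^sup>2 = to_ac (of_int (mat_discriminant X) * (Q $$ (i, j))\<^sup>2)"
    using Q ij by (simp add: detM q_def)
  finally show ?thesis by (rule algebraic_int_to_acD)
qed

section \<open>Finite residue rings and complete integral closure\<close>

text \<open>Independence over the integers implies independence over the rationals, so the dimension
  bounds the size. Integer coefficients allow divisibility arguments modulo a prime.\<close>

lemma number_field_card_le:
  assumes "number_field TYPE('k::field_char_0)"
  shows "\<exists>d. \<forall>B::'k::field_char_0 set. finite B \<longrightarrow>
    (\<forall>a::'k \<Rightarrow> int. (\<Sum>b\<in>B. of_int (a b) * b) = 0 \<longrightarrow> (\<forall>b\<in>B. a b = 0)) \<longrightarrow> card B \<le> d"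
proof -
  obtain E where "finite_dimensional_vector_space (\<lambda>(q::rat) (x::'k). of_rat q * x) E"
    using assms unfolding number_field_def by blast
  then interpret finite_dimensional_vector_space "\<lambda>(q::rat) (x::'k). of_rat q * x" E .
  show ?thesis
  proof (intro exI[of _ "card E"] allI impI)
    fix B :: "'k set"
    assume B: "finite B"
      and indep: "\<forall>a::'k \<Rightarrow> int. (\<Sum>b\<in>B. of_int (a b) * b) = 0 \<longrightarrow> (\<forall>b\<in>B. a b = 0)"
    have "u b = 0" if u: "(\<Sum>b\<in>B. of_rat (u b) * b) = 0" and b: "b \<in> B" for u b
    proof -
      \<comment> \<open>A common denominator of the coefficients, turning a rational relation into
        an integer one.\<close>
      define D where "D = (\<Prod>b\<in>B. snd (quotient_of (u b)))"
      have D: "D \<noteq> 0" unfolding D_def using B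
        by (simp add: prod_zero_iff) (metis quotient_of_denom_pos' less_irrefl)
      have "\<exists>k. u b * of_int D = of_int k" if "b \<in> B" for b
      proof -
        have "snd (quotient_of (u b)) dvd D" unfolding D_def using B that by (rule dvd_prodI)
        then obtain c where c: "D = snd (quotient_of (u b)) * c" by blast
        have "u b = of_int (fst (quotient_of (u b))) / of_int (snd (quotient_of (u b)))"
          by (rule quotient_of_div) simp
        moreover have "snd (quotient_of (u b)) \<noteq> 0" using quotient_of_denom_pos'[of "u b"] by simp
        ultimately have "u b * of_int D = of_int (fst (quotient_of (u b)) * c)"
          unfolding c by (simp add: field_simps)
        then show ?thesis ..
      qed
      then obtain a where a: "\<And>b. b \<in> B \<Longrightarrow> u b * of_int D = of_int (a b)" by metis
      have "(\<Sum>b\<in>B. of_int (a b) * b) = (\<Sum>b\<in>B. of_rat (of_int (a b)) * b)" by simp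
      also have "\<dots> = (\<Sum>b\<in>B. of_rat (u b * of_int D) * b)"
        by (intro sum.cong refl) (simp add: a)
      also have "\<dots> = of_int D * (\<Sum>b\<in>B. of_rat (u b) * b)"
        by (simp add: of_rat_mult sum_distrib_left ac_simps)
      finally have "a b = 0" using indep u b by simp
      then show ?thesis using a[OF b] D by simp
    qed
    then have "independent B" using dependent_finite[OF B] by blast
    then show "card B \<le> card E"
      using independent_span_bound[OF finite_Basis, of B] by (simp add: span_Basis)
  qed
qed

text \<open>\<open>T\<close> meets every residue class modulo \<open>p\<close>. The classes form a
  vector space over the field with \<open>p\<close> elements, of dimension at most that of the
  number field.\<close>

lemma number_field_finite_residues_prime:
  assumes nf: "number_field TYPE('k::field_char_0)" and p: "Factorial_Ring.prime (p::nat)"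
  obtains T :: "'k::field_char_0 set" where "finite T" "\<And>t. t \<in> T \<Longrightarrow> algebraic_int t"
    "\<And>y. algebraic_int y \<Longrightarrow> \<exists>t\<in>T. algebraic_int ((y - t) / of_nat p)"
proof -
  have p0: "(of_nat p :: 'k) \<noteq> 0" using p by (auto simp: prime_gt_0_nat)
  obtain d where d: "\<And>B::'k set. finite B \<Longrightarrow>
    (\<And>a::'k \<Rightarrow> int. (\<Sum>b\<in>B. of_int (a b) * b) = 0 \<Longrightarrow> \<forall>b\<in>B. a b = 0) \<Longrightarrow> card B \<le> d"
    using number_field_card_le[OF nf] by blast
  \<comment> \<open>Families independent modulo \<open>p\<close> are independent over the rationals, hence of bounded size;
    a maximal one generates modulo \<open>p\<close>.\<close>
  define ind where "ind B \<longleftrightarrow> finite B \<and> (\<forall>b\<in>B. algebraic_int b) \<and>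
    (\<forall>a::'k \<Rightarrow> int. algebraic_int ((\<Sum>b\<in>B. of_int (a b) * b) / of_nat p) \<longrightarrow> (\<forall>b\<in>B. int p dvd a b))"
    for B :: "'k set"
  have card: "card B \<le> d" if B: "ind B" for B
  proof (rule d)
    show "finite B" using B by (simp add: ind_def)
    fix a :: "'k \<Rightarrow> int"
    assume a: "(\<Sum>b\<in>B. of_int (a b) * b) = 0"
    \<comment> \<open>Descent: dividing a relation by \<open>p ^ m\<close> leaves a relation, and
      independence modulo \<open>p\<close> yields one more factor \<open>p\<close> in every
      coefficient.\<close>
    have dvd: "\<forall>b\<in>B. int p ^ m dvd a b" for m
    proof (induction m)
      case (Suc m)
      then obtain c where c: "\<And>b. b \<in> B \<Longrightarrow> a b = int p ^ m * c b" unfolding dvd_def by metis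
      have "of_int (int p ^ m) * (\<Sum>b\<in>B. of_int (c b) * b) = (\<Sum>b\<in>B. of_int (a b) * b)"
        unfolding sum_distrib_left by (intro sum.cong refl) (simp add: c)
      then have "(\<Sum>b\<in>B. of_int (c b) * b) = 0" using a p0 by simp
      then have "\<forall>b\<in>B. int p dvd c b" using B unfolding ind_def by simp
      then show ?case using c by (simp add: mult.commute mult_dvd_mono)
    qed simp
    show "\<forall>b\<in>B. a b = 0"
    proof (intro ballI, rule ccontr)
      fix b assume b: "b \<in> B" "a b \<noteq> 0"
      \<comment> \<open>With this exponent \<open>p ^ ?m\<close> exceeds the absolute value of
        \<open>a b\<close>, against divisibility.\<close>
      let ?m = "nat \<bar>a b\<bar>"
      have "?m < p ^ ?m" using p by (intro power_gt_expt prime_gt_Suc_0_nat)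
      then have "\<bar>a b\<bar> < int p ^ ?m" by (metis nat_less_iff of_nat_power abs_ge_zero)
      moreover have "int p ^ ?m \<le> \<bar>a b\<bar>"
        using dvd[of ?m] b by (intro zdvd_imp_le) auto
      ultimately show False by simp
    qed
  qed
  have "ind {}" by (simp add: ind_def)
  then obtain B where B: "ind B" and max: "\<And>C. ind C \<Longrightarrow> card C \<le> card B"
    using ex_has_greatest_nat[of ind "{}" card "Suc d"] card by (metis less_Suc_eq_le)
  have fB: "finite B" and Balg: "\<And>b. b \<in> B \<Longrightarrow> algebraic_int b" using B by (auto simp: ind_def)
  have comb: "\<exists>c::'k \<Rightarrow> int. algebraic_int ((y - (\<Sum>b\<in>B. of_int (c b) * b)) / of_nat p)"
    if y: "algebraic_int y" for y
  proof (cases "y \<in> B")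
    case True
    then have "(\<Sum>b\<in>B. of_int (if b = y then 1 else 0) * b) = y"
      using fB by (simp add: if_distrib[of of_int] if_distrib[of "\<lambda>t. t * _"] cong: if_cong)
    then show ?thesis by (intro exI[of _ "\<lambda>b. if b = y then 1 else 0"]) simp
  next
    case False
    then have "\<not> ind (insert y B)" using max[of "insert y B"] fB by auto
    then obtain a :: "'k \<Rightarrow> int"
      where "algebraic_int ((\<Sum>b\<in>insert y B. of_int (a b) * b) / of_nat p)"
        and nd: "\<exists>b\<in>insert y B. \<not> int p dvd a b"
      using fB Balg y by (auto simp: ind_def)
    then have a: "algebraic_int ((of_int (a y) * y + (\<Sum>b\<in>B. of_int (a b) * b)) / of_nat p)"
      using False fB by simp
    \<comment> \<open>Otherwise the term with \<open>y\<close> could be subtracted as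
      \<open>p\<close> times an integral element, leaving a relation modulo \<open>p\<close> within
      the independent set \<open>B\<close>.\<close>
    have "\<not> int p dvd a y"
    proof
      assume dvd: "int p dvd a y"
      then obtain m where m: "a y = int p * m" by blast
      have "algebraic_int ((of_int (a y) * y + (\<Sum>b\<in>B. of_int (a b) * b)) / of_nat p - of_int m * y)"
        using a y by (intro algebraic_int_diff algebraic_int_mult) auto
      also have "(of_int (a y) * y + (\<Sum>b\<in>B. of_int (a b) * b)) / of_nat p - of_int m * y
          = (\<Sum>b\<in>B. of_int (a b) * b) / of_nat p"
        using p0 by (simp add: m field_simps)
      finally have "\<forall>b\<in>B. int p dvd a b" using B by (simp add: ind_def)
      then show False using nd dvd by blast
    qed
    \<comment> \<open>So \<open>a y\<close> is invertible modulo \<open>p\<close>, and the relation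
      can be solved for \<open>y\<close>.\<close>
    then have "coprime (a y) (int p)"
      using p by (simp add: coprime_commute prime_imp_coprime)
    then obtain u w where uw: "u * a y + w * int p = 1"
      using bezout_int[of "a y" "int p"] by auto
    have "algebraic_int (of_int u * ((of_int (a y) * y + (\<Sum>b\<in>B. of_int (a b) * b)) / of_nat p) + of_int w * y)"
      using a y by (intro algebraic_int_add algebraic_int_mult) auto
    also have "of_int u * ((of_int (a y) * y + (\<Sum>b\<in>B. of_int (a b) * b)) / of_nat p) + of_int w * y
        = ((of_int (u * a y + w * int p) * y + of_int u * (\<Sum>b\<in>B. of_int (a b) * b)) / of_nat p)"
      using p0 by (simp add: field_simps)
    also have "\<dots> = (y - (\<Sum>b\<in>B. of_int (- u * a b) * b)) / of_nat p"
      unfolding uw by (simp add: sum_distrib_left sum_negf mult.assoc)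
    finally show ?thesis by (rule exI[of _ "\<lambda>b. - u * a b"])
  qed
  \<comment> \<open>Reducing the coefficients modulo \<open>p\<close> leaves finitely many
    combinations.\<close>
  define T where "T = (\<lambda>c::'k \<Rightarrow> int. \<Sum>b\<in>B. of_int (c b) * b) ` (B \<rightarrow>\<^sub>E {0..<int p})"
  show thesis
  proof (rule that[of T])
    show "finite T" unfolding T_def using fB by (intro finite_imageI finite_PiE) auto
    show "algebraic_int t" if "t \<in> T" for t
      using that Balg by (auto simp: T_def intro!: algebraic_int_sum algebraic_int_mult)
    fix y :: 'k assume "algebraic_int y"
    then obtain c where c: "algebraic_int ((y - (\<Sum>b\<in>B. of_int (c b) * b)) / of_nat p)"
      using comb by blast
    define r where "r = (\<lambda>b\<in>B. c b mod int p)"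
    have "algebraic_int ((y - (\<Sum>b\<in>B. of_int (c b) * b)) / of_nat p + (\<Sum>b\<in>B. of_int (c b div int p) * b))"
      using c Balg by (intro algebraic_int_add algebraic_int_sum algebraic_int_mult) auto
    also have "(\<Sum>b\<in>B. of_int (c b) * b) = (\<Sum>b\<in>B. of_int (r b) * b) + of_nat p * (\<Sum>b\<in>B. of_int (c b div int p) * b)"
    proof -
      have "of_int (c b) * b = of_int (r b) * b + of_nat p * (of_int (c b div int p) * b)" if "b \<in> B" for b
      proof -
        have "c b = r b + int p * (c b div int p)" using that by (simp add: r_def)
        then have "(of_int (c b) :: 'k) = of_int (r b) + of_nat p * of_int (c b div int p)"
          by (metis of_int_add of_int_mult of_int_of_nat_eq)
        then show ?thesis by (simp add: algebra_simps)
      qed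
      then show ?thesis by (simp add: sum.distrib sum_distrib_left)
    qed
    finally have "algebraic_int ((y - (\<Sum>b\<in>B. of_int (r b) * b)) / of_nat p)"
      using p0 by (simp add: field_simps)
    moreover have "r \<in> B \<rightarrow>\<^sub>E {0..<int p}"
      using p by (auto simp: r_def prime_gt_0_nat)
    ultimately show "\<exists>t\<in>T. algebraic_int ((y - t) / of_nat p)"
      unfolding T_def by blast
  qed
qed

text \<open>Induction on the prime factors: if \<open>s\<close> represents modulo \<open>p\<close>
  and \<open>t\<close> modulo \<open>m\<close>, the sums \<open>s + p * t\<close> represent modulo
  \<open>p * m\<close>.\<close>

lemma number_field_finite_residues:
  assumes nf: "number_field TYPE('k::field_char_0)" and m: "(m::nat) > 0"
  shows "\<exists>T::'k::field_char_0 set. finite T \<and> (\<forall>t\<in>T. algebraic_int t) \<and>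
    (\<forall>y. algebraic_int y \<longrightarrow> (\<exists>t\<in>T. algebraic_int ((y - t) / of_nat m)))"
  using m
proof (induction m rule: prime_divisors_induct)
  case (unit m)
  then have "m = 1" by simp
  then show ?case by (intro exI[of _ "{0}"]) auto
next
  case (factor p m)
  then have "m > 0" by simp
  then obtain T :: "'k set" where T: "finite T" "\<And>t. t \<in> T \<Longrightarrow> algebraic_int t"
    "\<And>y. algebraic_int y \<Longrightarrow> \<exists>t\<in>T. algebraic_int ((y - t) / of_nat m)"
    using factor.IH by blast
  obtain S :: "'k set" where S: "finite S" "\<And>s. s \<in> S \<Longrightarrow> algebraic_int s"
    "\<And>y. algebraic_int y \<Longrightarrow> \<exists>s\<in>S. algebraic_int ((y - s) / of_nat p)"
    using number_field_finite_residues_prime[OF nf factor.hyps(1)] by metis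
  have nz: "(of_nat m :: 'k) \<noteq> 0" "(of_nat p :: 'k) \<noteq> 0" using factor.prems by auto
  let ?T = "(\<lambda>(s, t). s + of_nat p * t) ` (S \<times> T)"
  have "\<exists>t\<in>?T. algebraic_int ((y - t) / of_nat (p * m))" if y: "algebraic_int y" for y
  proof -
    obtain s where s: "s \<in> S" "algebraic_int ((y - s) / of_nat p)" using S(3)[OF y] by blast
    obtain t where t: "t \<in> T" "algebraic_int (((y - s) / of_nat p - t) / of_nat m)"
      using T(3)[OF s(2)] by blast
    have "((y - s) / of_nat p - t) / of_nat m = (y - (s + of_nat p * t)) / of_nat (p * m)"
      using nz by (simp add: field_simps)
    then show ?thesis using s(1) t by (intro bexI[of _ "s + of_nat p * t"]) auto
  qed
  moreover have "\<forall>t\<in>?T. algebraic_int t"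
    using S(2) T(2) by (auto intro!: algebraic_int_add algebraic_int_mult)
  ultimately show ?case using S(1) T(1) by (intro exI[of _ ?T]) auto
qed simp

section \<open>Consequences of the finiteness of residue rings\<close>

lemma number_field_pigeonhole:
  fixes f :: "nat \<Rightarrow> 'k::field_char_0"
  assumes nf: "number_field TYPE('k)" and m: "(m::nat) > 0" and f: "\<And>k. algebraic_int (f k)"
  obtains k l where "k < l" "algebraic_int ((f l - f k) / of_nat m)"
proof -
  obtain T :: "'k set" where T: "finite T" "\<forall>y. algebraic_int y \<longrightarrow> (\<exists>t\<in>T. algebraic_int ((y - t) / of_nat m))"
    using number_field_finite_residues[OF nf m] by blast
  then have "\<forall>k. \<exists>t. t \<in> T \<and> algebraic_int ((f k - t) / of_nat m)" using f by blast
  then obtain g where g: "\<And>k. g k \<in> T" "\<And>k. algebraic_int ((f k - g k) / of_nat m)"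
    by (metis (no_types))
  have "\<not> inj g" using T(1) g(1) by (metis finite_imageD finite_subset image_subsetI infinite_UNIV_nat)
  then obtain k l where kl: "k < l" "g k = g l"
    unfolding inj_def by (metis linorder_neqE_nat)
  have "algebraic_int ((f l - g l) / of_nat m - (f k - g k) / of_nat m)"
    using g(2) by (intro algebraic_int_diff)
  also have "(f l - g l) / of_nat m - (f k - g k) / of_nat m = (f l - f k) / of_nat m"
    using kl(2) by (simp add: diff_divide_distrib)
  finally show thesis using that kl(1) by blast
qed

text \<open>A substitute for the norm: the constant term of a polynomial relation for
  \<open>y\<close> is a multiple of \<open>y\<close>. Vanishing constant terms are divided out
  first, as \<open>y\<close> is nonzero.\<close>

lemma algebraic_int_dvd_nat:
  fixes y :: "'a::field_char_0"
  assumes y: "algebraic_int y" and nz: "y \<noteq> 0"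
  obtains N z where "(N::nat) > 0" "algebraic_int z" "of_nat N = y * z"
proof -
  obtain p where p: "poly (map_poly of_int p) y = 0" "Polynomial.lead_coeff p = (1::int)"
    using y unfolding algebraic_int_altdef_ipoly by blast
  then have "p \<noteq> 0" by auto
  with p(1) have "\<exists>N>0. \<exists>z. algebraic_int z \<and> of_nat N = y * z"
  proof (induction p)
    case (pCons a p)
    show ?case
    proof (cases "a = 0")
      case True
      then show ?thesis using pCons nz by (auto simp: map_poly_pCons)
    next
      case False
      let ?z = "poly (map_poly of_int p) y"
      have z: "algebraic_int ?z"
        unfolding poly_altdef using y
        by (auto intro!: algebraic_int_sum algebraic_int_mult algebraic_int_power)
      have eq: "of_int a + y * ?z = 0" using pCons.prems by (simp add: map_poly_pCons)
      have "of_nat (nat \<bar>a\<bar>) = y * (of_int (- sgn a) * ?z)"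
      proof -
        have "(of_nat (nat \<bar>a\<bar>) :: 'a) = of_int (sgn a) * of_int a"
          by (simp flip: of_int_mult) (simp add: abs_sgn mult.commute)
        also have "of_int a = - (y * ?z)" using eq by (simp add: eq_neg_iff_add_eq_0)
        finally show ?thesis by simp
      qed
      moreover have "algebraic_int (of_int (- sgn a) * ?z)"
        by (intro algebraic_int_mult z) simp
      ultimately show ?thesis using False by (intro exI[of _ "nat \<bar>a\<bar>"]) auto
    qed
  qed simp
  then show thesis using that by blast
qed

text \<open>Finite residue rings take the place of the Noetherian property: a positive integer
  \<open>N\<close> is a common denominator of all powers of \<open>x\<close>, and two of the
  elements \<open>N * x ^ k\<close> agree modulo \<open>N\<close>.\<close>

lemma number_field_completely_integrally_closed:
  fixes x :: "'k::field_char_0"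
  assumes nf: "number_field TYPE('k)" and nz: "a \<noteq> 0" and int: "\<And>k. algebraic_int (a * x ^ k)"
  shows "algebraic_int x"
proof -
  have "algebraic_int a" using int[of 0] by simp
  then obtain N z where N: "(N::nat) > 0" "algebraic_int z" "of_nat N = a * z"
    using nz by (rule algebraic_int_dvd_nat)
  have "algebraic_int (of_nat N * x ^ k)" for k
    using algebraic_int_mult[OF N(2) int[of k]] by (simp add: N(3) ac_simps)
  \<comment> \<open>The pigeonhole makes \<open>x\<close> a root of the monic polynomial \<open>T^l - T^k - y\<close> with integral \<open>y\<close>.\<close>
  then obtain k l where kl: "k < l" "algebraic_int ((of_nat N * x ^ l - of_nat N * x ^ k) / of_nat N)"
    using number_field_pigeonhole[OF nf N(1), of "\<lambda>k. of_nat N * x ^ k"] by blast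
  have y: "algebraic_int (x ^ l - x ^ k)"
    using kl(2) N(1) by (simp flip: right_diff_distrib)
  let ?p = "Polynomial.monom 1 l - Polynomial.monom 1 k :: 'k poly"
  have c: "Polynomial.coeff ?p l = 1" using kl(1) by simp
  have "Polynomial.degree ?p = l"
  proof (rule antisym)
    show "Polynomial.degree ?p \<le> l"
      using kl(1) by (intro degree_diff_le) (auto simp: Polynomial.degree_monom_eq)
    show "l \<le> Polynomial.degree ?p" using c by (intro le_degree) simp
  qed
  then show ?thesis
    using c kl(1) by (intro algebraic_int_root[OF y, of ?p]) (auto simp: poly_monom)
qed

section \<open>Invertibility of prime ideals\<close>

lemma ring_of_integers_sel [simp]:
  "carrier \<O>\<^sub>K = {x::'k::field_char_0. algebraic_int x}"
  "x \<otimes>\<^bsub>\<O>\<^sub>K\<^esub> y = x * (y::'k)" "x \<oplus>\<^bsub>\<O>\<^sub>K\<^esub> y = x + (y::'k)"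
  "\<one>\<^bsub>\<O>\<^sub>K\<^esub> = (1::'k)" "\<zero>\<^bsub>\<O>\<^sub>K\<^esub> = (0::'k)"
  by (simp_all add: ring_of_integers_def)

lemma cring_ring_of_integers: "cring (\<O>\<^sub>K :: 'k::field_char_0 ring)"
proof (rule cringI)
  show "abelian_group (\<O>\<^sub>K :: 'k ring)"
    by (rule abelian_groupI) (auto intro: algebraic_int_add exI[of _ "- _"] bexI[of _ "- _"])
  show "comm_monoid (\<O>\<^sub>K :: 'k ring)"
    by (rule comm_monoidI) (auto intro: algebraic_int_mult)
qed (auto simp: algebra_simps)

lemma ideal_ring_of_integersD:
  fixes I :: "'k::field_char_0 set"
  assumes "ideal I \<O>\<^sub>K"
  shows "x \<in> I \<Longrightarrow> algebraic_int x" "0 \<in> I"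
    "x \<in> I \<Longrightarrow> y \<in> I \<Longrightarrow> x + y \<in> I"
    "algebraic_int r \<Longrightarrow> x \<in> I \<Longrightarrow> r * x \<in> I"
  using ideal.Icarr[OF assms, of x] additive_subgroup.zero_closed[OF ideal.axioms(1)[OF assms]]
    additive_subgroup.a_closed[OF ideal.axioms(1)[OF assms], of x y]
    ideal.I_l_closed[OF assms, of x r]
  by simp_all

lemma ideal_ring_of_integersI:
  fixes I :: "'k::field_char_0 set"
  assumes "\<And>x. x \<in> I \<Longrightarrow> algebraic_int x" "0 \<in> I"
    "\<And>x y. x \<in> I \<Longrightarrow> y \<in> I \<Longrightarrow> x + y \<in> I"
    "\<And>r x. algebraic_int r \<Longrightarrow> x \<in> I \<Longrightarrow> r * x \<in> I"
  shows "ideal I \<O>\<^sub>K"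
proof -
  interpret cring "\<O>\<^sub>K :: 'k ring" by (rule cring_ring_of_integers)
  have inv: "inv\<^bsub>add_monoid \<O>\<^sub>K\<^esub> x = - x" if "x \<in> I" for x :: 'k
    using minus_equality[of "- x" x] assms(1)[OF that] by (simp add: a_inv_def)
  show ?thesis
  proof (rule idealI)
    show "subgroup I (add_monoid \<O>\<^sub>K)"
    proof
      show "inv\<^bsub>add_monoid \<O>\<^sub>K\<^esub> x \<in> I" if "x \<in> I" for x
      proof -
        have "- 1 * x \<in> I" using that by (intro assms(4)) simp_all
        then show ?thesis unfolding inv[OF that] by simp
      qed
      show "I \<subseteq> carrier (add_monoid \<O>\<^sub>K)" using assms(1) by auto
      show "x \<otimes>\<^bsub>add_monoid \<O>\<^sub>K\<^esub> y \<in> I" if "x \<in> I" "y \<in> I" for x y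
        using assms(3)[OF that] by simp
      show "\<one>\<^bsub>add_monoid \<O>\<^sub>K\<^esub> \<in> I" using assms(2) by simp
    qed
    show "ring (\<O>\<^sub>K :: 'k ring)" by (rule ring_axioms)
    show "x \<otimes>\<^bsub>\<O>\<^sub>K\<^esub> a \<in> I" "a \<otimes>\<^bsub>\<O>\<^sub>K\<^esub> x \<in> I" if "a \<in> I" "x \<in> carrier \<O>\<^sub>K" for a x
      using assms(4)[of x a] that by (simp_all add: mult.commute)
  qed
qed

lemma sum_in_ideal_prod:
  fixes x y :: "'k::field_char_0"
  shows "x \<in> ideal_prod \<O>\<^sub>K I J \<Longrightarrow> y \<in> ideal_prod \<O>\<^sub>K I J \<Longrightarrow> x + y \<in> ideal_prod \<O>\<^sub>K I J"
  using ideal_prod.sum[of x "\<O>\<^sub>K" I J y] by simp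

lemma mult_in_ideal_prod:
  fixes x y :: "'k::field_char_0"
  shows "x \<in> I \<Longrightarrow> y \<in> J \<Longrightarrow> x * y \<in> ideal_prod \<O>\<^sub>K I J"
  using ideal_prod.prod[of x I y J "\<O>\<^sub>K"] by simp

section \<open>Arithmetic of a nonzero prime ideal\<close>

locale nonzero_prime =
  fixes P :: "'k::field_char_0 set"
  assumes nf: "number_field TYPE('k)" and P: "nonzero_prime_ideal P"
begin

lemma primeideal: "primeideal P \<O>\<^sub>K"
  using P by (simp add: nonzero_prime_ideal_def)

lemma ideal: "ideal P \<O>\<^sub>K"
  using primeideal by (rule primeideal.axioms)

lemmas P_algebraic_int = ideal_ring_of_integersD(1)[OF ideal]
  and P_0 = ideal_ring_of_integersD(2)[OF ideal]
  and P_add = ideal_ring_of_integersD(3)[OF ideal]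
  and P_mult = ideal_ring_of_integersD(4)[OF ideal]

lemma P_diff: "x \<in> P \<Longrightarrow> y \<in> P \<Longrightarrow> x - y \<in> P"
  using P_add[of x "- 1 * y"] P_mult[of "- 1" y] by simp

lemma P_1: "1 \<notin> P"
proof
  assume "1 \<in> P"
  then have "P = carrier \<O>\<^sub>K" using P_mult[of _ 1] P_algebraic_int by auto
  then show False using primeideal.I_notcarr[OF primeideal] by simp
qed

lemma P_prime: "algebraic_int x \<Longrightarrow> algebraic_int y \<Longrightarrow> x * y \<in> P \<Longrightarrow> x \<in> P \<or> y \<in> P"
  using primeideal.I_prime[OF primeideal, of x y] by simp

lemma P_prod: "finite S \<Longrightarrow> (\<And>s. s \<in> S \<Longrightarrow> algebraic_int (f s) \<and> f s \<notin> P) \<Longrightarrow> prod f S \<notin> P"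
  by (induction S rule: finite_induct) (auto simp: P_1 dest!: P_prime intro: algebraic_int_prod)

text \<open>A nonzero element of \<open>P\<close> divides some positive integer, which then lies in
  \<open>P\<close>, and primality of \<open>P\<close> passes to one of its prime factors.\<close>

lemma prime_below:
  obtains p where "Factorial_Ring.prime (p::nat)" "of_nat p \<in> P"
proof -
  obtain y where y: "y \<in> P" "y \<noteq> 0"
    using P P_0 by (auto simp: nonzero_prime_ideal_def)
  obtain N z where N: "(N::nat) > 0" "algebraic_int z" "of_nat N = y * z"
    using algebraic_int_dvd_nat[OF P_algebraic_int[OF y(1)] y(2)] .
  then have "of_nat N \<in> P" using P_mult[OF N(2) y(1)] by (simp add: mult.commute)
  with N(1) have "\<exists>p. Factorial_Ring.prime (p::nat) \<and> of_nat p \<in> P"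
  proof (induction N rule: prime_divisors_induct)
    case (unit N)
    then show ?case using P_1 by simp
  next
    case (factor p N)
    then show ?case using P_prime[of "of_nat p" "of_nat N"] by auto
  qed simp
  then show thesis using that by blast
qed

lemma of_int_mem_iff:
  assumes p: "Factorial_Ring.prime (p::nat)" "of_nat p \<in> P"
  shows "of_int k \<in> P \<longleftrightarrow> int p dvd k"
proof
  assume "int p dvd k"
  then obtain m where "k = m * int p" by (metis dvd_def mult.commute)
  then show "of_int k \<in> P" using P_mult[OF _ p(2), of "of_int m"] by simp
next
  assume k: "of_int k \<in> P"
  show "int p dvd k"
  proof (rule ccontr)
    assume "\<not> int p dvd k"
    then have "coprime k (int p)"
      using p(1) prime_imp_coprime[of "int p" k] by (simp add: coprime_commute)
    then obtain u w where "u * k + w * int p = 1" using bezout_int[of k "int p"] by auto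
    then have "(1::'k) = of_int u * of_int k + of_int w * of_nat p"
      by (metis of_int_1 of_int_add of_int_mult of_int_of_nat_eq)
    also have "\<dots> \<in> P" using k p by (intro P_add P_mult) auto
    finally show False using P_1 by simp
  qed
qed

lemma lies_above:
  assumes "Factorial_Ring.prime (p::nat)" "of_nat p \<in> P"
  shows "lies_above P p"
  unfolding lies_above_def using of_int_mem_iff[OF assms] by (auto elim!: Ints_cases)

text \<open>Two powers of \<open>y\<close> agree modulo \<open>p\<close>. For \<open>y\<close>
  outside \<open>P\<close> this gives an inverse modulo \<open>P\<close>; for \<open>y\<close> in
  \<open>P\<close> it gives a factor \<open>1 - y ^ d\<close> outside \<open>P\<close> whose product
  with a power of \<open>y\<close> is divisible by \<open>p\<close>.\<close>

lemma power_mem_modulo: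
  fixes y :: 'k
  assumes p: "Factorial_Ring.prime (p::nat)" "of_nat p \<in> P" and y: "algebraic_int y"
  obtains k d where "d > 0" "algebraic_int (y ^ k * (1 - y ^ d) / of_nat p)"
proof -
  have "p > 0" using p by (auto simp: prime_gt_0_nat)
  then obtain k l where kl: "k < l" "algebraic_int ((y ^ l - y ^ k) / of_nat p)"
    using number_field_pigeonhole[OF nf, of p "\<lambda>k. y ^ k"] algebraic_int_power[OF y] by blast
  have "y ^ k * (1 - y ^ (l - k)) = - (y ^ l - y ^ k)"
    using kl(1) by (simp add: right_diff_distrib flip: power_add)
  then have "algebraic_int (y ^ k * (1 - y ^ (l - k)) / of_nat p)"
    using kl(2) by (simp only: minus_divide_left[symmetric] algebraic_int_minus_iff)
  then show thesis using that[of "l - k" k] kl(1) by simp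
qed

lemma P_power: "y \<in> P \<Longrightarrow> d > 0 \<Longrightarrow> y ^ d \<in> P"
  by (cases d) (auto simp: power_commutes[symmetric] intro: P_mult algebraic_int_power P_algebraic_int simp del: power_Suc2)

lemma P_powerD: "algebraic_int y \<Longrightarrow> y ^ k \<in> P \<Longrightarrow> y \<in> P"
proof (induction k)
  case (Suc k)
  then show ?case using P_prime[of y "y ^ k"] by (auto intro: algebraic_int_power)
qed (simp add: P_1)

text \<open>Since \<open>y ^ k\<close> lies outside \<open>P\<close>, the factor
  \<open>1 - y ^ d\<close> lies in \<open>P\<close>, so \<open>y ^ (d - 1)\<close> inverts
  \<open>y\<close> modulo \<open>P\<close>.\<close>

lemma maximal:
  assumes y: "algebraic_int y" "y \<notin> P"
  obtains a z where "algebraic_int a" "z \<in> P" "1 = a * y + z"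
proof -
  obtain p where p: "Factorial_Ring.prime (p::nat)" "of_nat p \<in> P" by (rule prime_below)
  obtain k d where d: "d > 0" "algebraic_int (y ^ k * (1 - y ^ d) / of_nat p)"
    using power_mem_modulo[OF p y(1)] .
  have p0: "(of_nat p :: 'k) \<noteq> 0" using p by (auto simp: prime_gt_0_nat)
  have "y ^ k * (1 - y ^ d) \<in> P"
    using P_mult[OF d(2) p(2)] p0 by simp
  then have "1 - y ^ d \<in> P"
    using P_prime[of "y ^ k" "1 - y ^ d"] P_powerD[OF y(1)] y
    by (auto intro: algebraic_int_power algebraic_int_diff)
  moreover have "1 = y ^ (d - 1) * y + (1 - y ^ d)"
    using d(1) by (simp flip: power_Suc2)
  ultimately show thesis using that[of "y ^ (d - 1)" "1 - y ^ d"] y by (auto intro: algebraic_int_power)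
qed

text \<open>The inverse fractional ideal of \<open>P\<close> is strictly larger than the ring of
  integers.\<close>

lemma nonintegral_multiplier: "\<exists>x. \<not> algebraic_int x \<and> (\<forall>y\<in>P. algebraic_int (x * y))"
proof -
  obtain p where p: "Factorial_Ring.prime (p::nat)" "of_nat p \<in> P" by (rule prime_below)
  have pos: "p > 0" using p by (auto simp: prime_gt_0_nat)
  then have p0: "(of_nat p :: 'k) \<noteq> 0" by simp
  obtain T :: "'k set" where T: "finite T" "\<And>t. t \<in> T \<Longrightarrow> algebraic_int t"
    "\<And>y. algebraic_int y \<Longrightarrow> \<exists>t\<in>T. algebraic_int ((y - t) / of_nat p)"
    using number_field_finite_residues[OF nf pos] by blast
  \<comment> \<open>\<open>T \<inter> P\<close> represents \<open>P\<close> modulo \<open>p\<close>: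
    as \<open>p\<close> lies in \<open>P\<close>, a representative of an element of \<open>P\<close>
    is again in \<open>P\<close>.\<close>
  have rep: "\<exists>t\<in>T \<inter> P. algebraic_int ((y - t) / of_nat p)" if "y \<in> P" for y
  proof -
    obtain t where t: "t \<in> T" "algebraic_int ((y - t) / of_nat p)"
      using T(3) P_algebraic_int[OF \<open>y \<in> P\<close>] by blast
    have "y - (y - t) / of_nat p * of_nat p \<in> P"
      using that t(2) p(2) by (intro P_diff P_mult)
    then show ?thesis using t p0 by auto
  qed
  \<comment> \<open>Up to a factor \<open>s\<close> outside \<open>P\<close>, every element of
    \<open>P\<close> is nilpotent modulo \<open>p\<close>.\<close>
  have "\<exists>s k. algebraic_int s \<and> s \<notin> P \<and> algebraic_int (s * y ^ k / of_nat p)" if y: "y \<in> P" for y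
  proof -
    obtain k d where d: "d > 0" "algebraic_int (y ^ k * (1 - y ^ d) / of_nat p)"
      using power_mem_modulo[OF p P_algebraic_int[OF y]] .
    have "1 - y ^ d \<notin> P"
    proof
      assume "1 - y ^ d \<in> P"
      then have "1 - y ^ d + y ^ d \<in> P" using P_power[OF y d(1)] by (rule P_add)
      then show False using P_1 by simp
    qed
    moreover have "algebraic_int (1 - y ^ d)"
      using P_algebraic_int[OF y] by (intro algebraic_int_diff algebraic_int_power) auto
    ultimately show ?thesis using d(2) by (metis mult.commute)
  qed
  then obtain s k where s: "\<And>y. y \<in> P \<Longrightarrow> algebraic_int (s y)" "\<And>y. y \<in> P \<Longrightarrow> s y \<notin> P"
    and sk: "\<And>y. y \<in> P \<Longrightarrow> algebraic_int (s y * y ^ k y / of_nat p)"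
    by metis
  \<comment> \<open>The witness is \<open>b / p\<close> with \<open>b \<noteq> 0\<close> annihilated by \<open>P\<close> modulo \<open>p\<close>. Starting from \<open>b0\<close>, which is
    annihilated by a power of each generator, \<open>b\<close> is multiplied by the largest power of each
    generator that keeps it nonzero modulo \<open>p\<close>.\<close>
  define b0 where "b0 = (\<Prod>t\<in>T \<inter> P. s t)"
  have "algebraic_int b0" unfolding b0_def using s(1) by (intro algebraic_int_prod) auto
  moreover have "b0 \<notin> P" unfolding b0_def using s T(1) by (intro P_prod) auto
  ultimately have b0: "algebraic_int b0" "b0 \<notin> P" by blast+
  have b0_power: "algebraic_int (b0 * t ^ k t / of_nat p)" if t: "t \<in> T \<inter> P" for t
  proof -
    have "b0 = s t * prod s (T \<inter> P - {t})" unfolding b0_def using T(1) t by (intro prod.remove) auto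
    then have "b0 * t ^ k t / of_nat p = prod s (T \<inter> P - {t}) * (s t * t ^ k t / of_nat p)" by simp
    also have "algebraic_int \<dots>"
      using t s(1) by (intro algebraic_int_mult algebraic_int_prod sk) auto
    finally show ?thesis .
  qed
  have "\<exists>b. algebraic_int b \<and> \<not> algebraic_int (b / of_nat p) \<and>
      (\<forall>t\<in>T \<inter> P. algebraic_int (b * t ^ k t / of_nat p)) \<and> (\<forall>t\<in>F. algebraic_int (b * t / of_nat p))"
    if "finite F" "F \<subseteq> T \<inter> P" for F
    using that
  proof (induction F rule: finite_induct)
    case empty
    \<comment> \<open>\<open>b0\<close> is \<open>p\<close> times this quotient, so integrality
      would put \<open>b0\<close> into \<open>P\<close>.\<close>
    have "\<not> algebraic_int (b0 / of_nat p)"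
      using P_mult[OF _ p(2), of "b0 / of_nat p"] b0(2) p0 by auto
    then show ?case using b0 b0_power by auto
  next
    case (insert t F)
    then obtain b where b: "algebraic_int b" "\<not> algebraic_int (b / of_nat p)"
      "\<And>t. t \<in> T \<inter> P \<Longrightarrow> algebraic_int (b * t ^ k t / of_nat p)"
      "\<And>t. t \<in> F \<Longrightarrow> algebraic_int (b * t / of_nat p)"
      by auto
    have t: "t \<in> T \<inter> P" using insert.prems by simp
    define m where "m = (LEAST m. algebraic_int (b * t ^ m / of_nat p))"
    have m: "algebraic_int (b * t ^ m / of_nat p)"
      unfolding m_def by (rule LeastI[where P = "\<lambda>m. algebraic_int (b * t ^ m / of_nat p)", OF b(3)[OF t]])
    \<comment> \<open>The case \<open>m = 0\<close> is excluded because \<open>b / p\<close> is not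
      integral.\<close>
    then obtain j where j: "m = Suc j" using b(2) by (cases m) auto
    have nj: "\<not> algebraic_int (b * t ^ j / of_nat p)"
      using not_less_Least[of j "\<lambda>m. algebraic_int (b * t ^ m / of_nat p)"] j by (simp add: m_def)
    have tj: "algebraic_int (t ^ j)" using T(2) t by (intro algebraic_int_power) auto
    have mult: "algebraic_int (b * t ^ j * c / of_nat p)" if "algebraic_int (b * c / of_nat p)" for c
      using algebraic_int_mult[OF tj that] by (simp add: ac_simps)
    have "algebraic_int (b * t ^ j * t / of_nat p)" using m by (simp add: j mult.assoc mult.commute[of t])
    then show ?case
      using b mult nj tj by (intro exI[of _ "b * t ^ j"]) (auto intro: algebraic_int_mult)
  qed
  then have "\<exists>b. algebraic_int b \<and> \<not> algebraic_int (b / of_nat p) \<and>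
      (\<forall>t\<in>T \<inter> P. algebraic_int (b * t / of_nat p))"
    using T(1) by (meson finite_Int order_refl)
  then obtain b where b: "\<not> algebraic_int (b / of_nat p)" "algebraic_int b"
    "\<And>t. t \<in> T \<inter> P \<Longrightarrow> algebraic_int (b * t / of_nat p)"
    by blast
  show ?thesis
  proof (intro exI conjI ballI)
    show "\<not> algebraic_int (b / of_nat p)" by (rule b(1))
    fix y assume "y \<in> P"
    then obtain t where t: "t \<in> T \<inter> P" "algebraic_int ((y - t) / of_nat p)" using rep by blast
    have "algebraic_int (b * ((y - t) / of_nat p) + b * t / of_nat p)"
      using b t by (intro algebraic_int_add algebraic_int_mult)
    also have "b * ((y - t) / of_nat p) + b * t / of_nat p = b / of_nat p * y"
      using p0 by (simp add: field_simps)
    finally show "algebraic_int (b / of_nat p * y)" .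
  qed
qed

text \<open>All \<open>a * x ^ k\<close> stay in \<open>I\<close>, so \<open>a\<close> is a common
  denominator of the powers of \<open>x\<close>.\<close>

lemma algebraic_int_if_stable:
  fixes x :: 'k
  assumes "a \<in> I" "a \<noteq> 0" "\<And>y. y \<in> I \<Longrightarrow> algebraic_int y" "\<And>y. y \<in> I \<Longrightarrow> x * y \<in> I"
  shows "algebraic_int x"
proof (rule number_field_completely_integrally_closed[OF nf assms(2)])
  fix k
  have "a * x ^ k \<in> I"
  proof (induction k)
    case (Suc k)
    then show ?case using assms(4)[OF Suc] by (simp add: ac_simps)
  qed (use assms(1) in simp)
  then show "algebraic_int (a * x ^ k)" by (rule assms(3))
qed

text \<open>Invertibility of \<open>P\<close> as one identity: \<open>x\<close> and 1 lie in its
  inverse, \<open>y\<close> and \<open>z\<close> in \<open>P\<close>. A nonintegral multiplier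
  cannot map \<open>P\<close> into itself, so it sends some \<open>y\<close> to an integral element
  outside \<open>P\<close>, to which \<open>maximal\<close> applies.\<close>

lemma invertible:
  obtains x y z where "\<And>w. w \<in> P \<Longrightarrow> algebraic_int (x * w)" "y \<in> P" "z \<in> P" "1 = x * y + z"
proof -
  obtain x where x: "\<not> algebraic_int x" "\<And>w. w \<in> P \<Longrightarrow> algebraic_int (x * w)"
    using nonintegral_multiplier by blast
  obtain y0 where y0: "y0 \<in> P" "y0 \<noteq> 0"
    using P P_0 by (auto simp: nonzero_prime_ideal_def)
  obtain y where y: "y \<in> P" "x * y \<notin> P"
    using algebraic_int_if_stable[OF y0 P_algebraic_int] x(1) by blast
  obtain a z where az: "algebraic_int a" "z \<in> P" "1 = a * (x * y) + z"
    using maximal[OF x(2)[OF y(1)] y(2)] .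
  show thesis
  proof (rule that[of "a * x" y z])
    show "algebraic_int (a * x * w)" if "w \<in> P" for w
      using algebraic_int_mult[OF az(1) x(2)[OF that]] by (simp add: mult.assoc)
  qed (use az y in \<open>auto simp: mult.assoc\<close>)
qed

text \<open>If the conclusion failed, a nonintegral multiplier of \<open>P\<close> would stabilise the denominator ideal of
  \<open>q\<close>, contradicting complete integral closure.\<close>

lemma denominator_witness:
  assumes den: "\<And>r. algebraic_int r \<Longrightarrow> algebraic_int (r * q) \<Longrightarrow> r \<in> P"
    and r0: "r0 \<noteq> 0" "algebraic_int r0" "algebraic_int (r0 * q)"
  obtains r where "r \<in> P" "algebraic_int (r * q)" "r * q \<notin> P"
proof (rule ccontr)
  assume "\<not> thesis"
  then have all: "\<And>r. r \<in> P \<Longrightarrow> algebraic_int (r * q) \<Longrightarrow> r * q \<in> P" using that by blast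
  obtain x where x: "\<not> algebraic_int x" "\<And>w. w \<in> P \<Longrightarrow> algebraic_int (x * w)"
    using nonintegral_multiplier by blast
  have "algebraic_int x"
  proof (rule algebraic_int_if_stable[of r0 "{r. algebraic_int r \<and> algebraic_int (r * q)}"])
    fix r assume "r \<in> {r. algebraic_int r \<and> algebraic_int (r * q)}"
    then have r: "algebraic_int r" "algebraic_int (r * q)" by auto
    then have "algebraic_int (x * r)" "algebraic_int (x * (r * q))" using x(2) den all by blast+
    then show "x * r \<in> {r. algebraic_int r \<and> algebraic_int (r * q)}" by (simp add: mult.assoc)
  qed (use r0 in auto)
  then show False using x(1) by simp
qed

lemma mult_in_square:
  assumes "y \<in> P" "z \<in> P" "algebraic_int c"
  shows "c * (y * z) \<in> ideal_prod \<O>\<^sub>K P P"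
  using mult_in_ideal_prod[OF P_mult[OF assms(3,1)] assms(2)] by (simp add: mult.assoc)

lemma mem_square_if_denominator:
  assumes den: "\<And>r. algebraic_int r \<Longrightarrow> algebraic_int (r * q) \<Longrightarrow> r \<in> P"
    and D: "D \<noteq> 0" "algebraic_int D" "algebraic_int (D * q\<^sup>2)"
  shows "D \<in> ideal_prod \<O>\<^sub>K P P"
proof -
  \<comment> \<open>This makes \<open>D\<close> itself a nonzero denominator of
    \<open>q\<close>.\<close>
  have "algebraic_int ((D * q)\<^sup>2)"
    using algebraic_int_mult[OF D(2,3)] by (simp add: power2_eq_square ac_simps)
  then have "algebraic_int (D * q)" by (rule algebraic_int_power2D)
  then obtain r where r: "r \<in> P" "algebraic_int (r * q)" "r * q \<notin> P"
    using denominator_witness[OF den D(1,2)] by blast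
  let ?b = "(r * q)\<^sup>2"
  have b: "algebraic_int ?b" "?b \<notin> P"
    using r P_powerD[of "r * q" 2] by (auto intro: algebraic_int_power)
  obtain a z where az: "algebraic_int a" "z \<in> P" "1 = a * ?b + z" using maximal[OF b] .
  \<comment> \<open>In the expansion of the squared identity, the terms containing \<open>?b\<close>
    carry the factor \<open>r * r\<close>, and the remaining one is
    \<open>D * (z * z)\<close>.\<close>
  have "D = D * (a * ?b + z)\<^sup>2" using az(3) by simp
  also have "\<dots> = a * (a * ?b + 2 * z) * (D * q\<^sup>2) * (r * r) + D * (z * z)"
    by (simp add: power2_eq_square algebra_simps)
  also have "\<dots> \<in> ideal_prod \<O>\<^sub>K P P"
    using az(1,2) b(1) D(2,3) r(1) P_algebraic_int
    by (intro sum_in_ideal_prod mult_in_square algebraic_int_mult[OF _ D(3)] algebraic_int_mult algebraic_int_add) auto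
  finally show ?thesis .
qed

lemma ideal_square: "ideal (ideal_prod \<O>\<^sub>K P P) \<O>\<^sub>K"
  using ring.ideal_prod_is_ideal[OF cring.axioms(1)[OF cring_ring_of_integers] ideal ideal] .

text \<open>To contain is to divide, because \<open>P\<close> is invertible. For nonzero
  \<open>m\<close> the cofactor \<open>C\<close> is \<open>m\<close> times the inverse of the square
  of \<open>P\<close>.\<close>

lemma square_dvd:
  assumes m: "m \<in> ideal_prod \<O>\<^sub>K P P"
  shows "ideal_dvd (ideal_prod \<O>\<^sub>K P P) (PIdl\<^bsub>\<O>\<^sub>K\<^esub> m)"
proof -
  let ?S = "ideal_prod \<O>\<^sub>K P P"
  note S = ideal_ring_of_integersD[OF ideal_square]
  have malg: "algebraic_int m" by (rule S(1)[OF m])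
  obtain x y z where x: "\<And>w. w \<in> P \<Longrightarrow> algebraic_int (x * w)"
    and yz: "y \<in> P" "z \<in> P" "1 = x * y + z" by (rule invertible) blast
  have x2: "algebraic_int (x * x * w)" if "w \<in> ?S" for w
    using that
  proof (induction w rule: ideal_prod.induct)
    case (prod i j)
    then show ?case using algebraic_int_mult[OF x[of i] x[of j]] by (simp add: ac_simps)
  next
    case (sum s1 s2)
    then show ?case by (simp add: distrib_left algebraic_int_add)
  qed
  have x1: "algebraic_int (x * w)" if "w \<in> ?S" for w
    using that
  proof (induction w rule: ideal_prod.induct)
    case (prod i j)
    then show ?case
      using algebraic_int_mult[OF x[of i] P_algebraic_int[of j]] by (simp add: ac_simps)
  next
    case (sum s1 s2)
    then show ?case by (simp add: distrib_left algebraic_int_add)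
  qed
  define C where "C = {c. algebraic_int c \<and> (\<forall>w\<in>?S. algebraic_int (c * w / m))}"
  have C: "ideal C \<O>\<^sub>K"
  proof (rule ideal_ring_of_integersI)
    show "c + c' \<in> C" if "c \<in> C" "c' \<in> C" for c c'
      using that by (auto simp: C_def distrib_right add_divide_distrib intro: algebraic_int_add)
    show "r * c \<in> C" if "algebraic_int r" "c \<in> C" for r c
      using that by (auto simp: C_def mult.assoc intro: algebraic_int_mult simp flip: times_divide_eq_right)
  qed (auto simp: C_def)
  show ?thesis
  proof (cases "m = 0")
    case True
    \<comment> \<open>Division by zero gives 0, so \<open>C\<close> would be the whole ring here;
      the zero ideal is the cofactor instead.\<close>
    have "ideal_prod \<O>\<^sub>K ?S {0} = {0}"
    proof (intro equalityI subsetI)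
      fix w assume "w \<in> ideal_prod \<O>\<^sub>K ?S {0}"
      then show "w \<in> {0}" by induction auto
    next
      fix w :: 'k assume "w \<in> {0}"
      then show "w \<in> ideal_prod \<O>\<^sub>K ?S {0}" using mult_in_ideal_prod[OF S(2), of 0 "{0}"] by simp
    qed
    moreover have "ideal {0} (\<O>\<^sub>K :: 'k ring)" by (rule ideal_ring_of_integersI) auto
    ultimately show ?thesis
      using True unfolding ideal_dvd_def cgenideal_def by (intro exI[of _ "{0}"]) auto
  next
    case False
    have mC: "m * x\<^sup>2 \<in> C" "m * x \<in> C" "m \<in> C"
      using m malg False x1 x2 S(1)
      by (auto simp: C_def power2_eq_square ac_simps)
    have "ideal_prod \<O>\<^sub>K ?S C = PIdl\<^bsub>\<O>\<^sub>K\<^esub> m"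
    proof (intro equalityI subsetI)
      fix w assume "w \<in> ideal_prod \<O>\<^sub>K ?S C"
      then have "algebraic_int (w / m)"
      proof induction
        case (prod i j)
        then show ?case by (auto simp: C_def mult.commute)
      next
        case (sum s1 s2)
        then show ?case by (auto simp: add_divide_distrib intro: algebraic_int_add)
      qed
      then show "w \<in> PIdl\<^bsub>\<O>\<^sub>K\<^esub> m"
        unfolding cgenideal_def using False by (auto intro!: exI[of _ "w / m"])
    next
      fix w assume "w \<in> PIdl\<^bsub>\<O>\<^sub>K\<^esub> m"
      then obtain u where u: "algebraic_int u" "w = u * m" by (auto simp: cgenideal_def)
      \<comment> \<open>Squaring \<open>1 = x * y + z\<close> pairs \<open>y * y\<close>,
        \<open>y * z\<close>, \<open>z * z\<close> from the square of \<open>P\<close> with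
        \<open>m * x\<^sup>2\<close>, \<open>m * x\<close>, \<open>m\<close> from
        \<open>C\<close>.\<close>
      have "w = u * m * (x * y + z)\<^sup>2" using u(2) yz(3) by simp
      also have "\<dots> = u * (y * y) * (m * x\<^sup>2) + 2 * u * (y * z) * (m * x) + u * (z * z) * m"
        by (simp add: power2_eq_square algebra_simps)
      also have "\<dots> \<in> ideal_prod \<O>\<^sub>K ?S C"
        using u(1) yz(1,2) mC
        by (intro sum_in_ideal_prod mult_in_ideal_prod[of _ ?S] mult_in_square algebraic_int_mult) auto
      finally show "w \<in> ideal_prod \<O>\<^sub>K ?S C" .
    qed
    then show ?thesis unfolding ideal_dvd_def using C by blast
  qed
qed

lemma square_cases:
  assumes p: "Factorial_Ring.prime (p::nat)" "of_nat p \<in> P"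
    and D: "of_int D \<in> ideal_prod \<O>\<^sub>K P P"
  shows "int p dvd D" "\<not> (int p)\<^sup>2 dvd D \<Longrightarrow> of_nat p \<in> ideal_prod \<O>\<^sub>K P P"
proof -
  note S = ideal_ring_of_integersD[OF ideal_square]
  have "of_int D \<in> P"
    using D ring.ideal_prod_inter[OF cring.axioms(1)[OF cring_ring_of_integers] ideal ideal] by blast
  then show "int p dvd D" using of_int_mem_iff[OF p] by simp
  then obtain e where e: "D = int p * e" by blast
  assume "\<not> (int p)\<^sup>2 dvd D"
  then have "\<not> int p dvd e" by (auto simp: e power2_eq_square)
  then have "coprime e (int p)"
    using p(1) prime_imp_coprime[of "int p" e] by (simp add: coprime_commute)
  then obtain u w where uw: "u * e + w * int p = 1" using bezout_int[of e "int p"] by auto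
  \<comment> \<open>The Bezout identity for \<open>e\<close> and \<open>p\<close>, multiplied by
    \<open>p\<close>, expresses \<open>p\<close> through \<open>D\<close> and
    \<open>p * p\<close>.\<close>
  have "int p = int p * (u * e + w * int p)" unfolding uw by simp
  also have "\<dots> = u * D + w * (int p * int p)" unfolding e by (simp add: algebra_simps)
  finally have "int p = u * D + w * (int p * int p)" .
  from arg_cong[OF this, of "of_int :: int \<Rightarrow> 'k"]
  have "(of_nat p :: 'k) = of_int u * of_int D + of_int w * (of_nat p * of_nat p)" by simp
  also have "\<dots> \<in> ideal_prod \<O>\<^sub>K P P"
    by (intro S(3) S(4) mult_in_ideal_prod D p) auto
  finally show "of_nat p \<in> ideal_prod \<O>\<^sub>K P P" .
qed

end

text \<open>If every entry had a denominator outside \<open>P\<close>, the product of these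
  denominators would lie in the level, hence in \<open>P\<close>, against primality. Divisibility is
  used as the inclusion of the level in \<open>P\<close>.\<close>

lemma (in nonzero_prime) entry_denominator:
  assumes lvl: "ideal_dvd P (level Q)" and Q: "Q \<in> carrier_mat n n"
  obtains i j where "i < n" "j < n"
    "\<And>r. algebraic_int r \<Longrightarrow> algebraic_int (r * Q $$ (i, j)) \<Longrightarrow> r \<in> P"
proof (rule ccontr)
  assume neg: "\<not> thesis"
  note witness = that
  have "\<exists>r. algebraic_int r \<and> algebraic_int (r * Q $$ ij) \<and> r \<notin> P" if "ij \<in> {..<n} \<times> {..<n}" for ij
    using neg witness[of "fst ij" "snd ij"] that by (cases ij) auto
  then obtain r where r: "\<And>ij. ij \<in> {..<n} \<times> {..<n} \<Longrightarrow> algebraic_int (r ij) \<and> r ij \<notin> P"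
    and rQ: "\<And>ij. ij \<in> {..<n} \<times> {..<n} \<Longrightarrow> algebraic_int (r ij * Q $$ ij)"
    by metis
  let ?s = "prod r ({..<n} \<times> {..<n})"
  have "algebraic_int (?s * Q $$ ij)" if ij: "ij \<in> {..<n} \<times> {..<n}" for ij
  proof -
    have "?s = r ij * prod r ({..<n} \<times> {..<n} - {ij})" using ij by (intro prod.remove) auto
    then have "?s * Q $$ ij = prod r ({..<n} \<times> {..<n} - {ij}) * (r ij * Q $$ ij)" by simp
    also have "algebraic_int \<dots>"
      using r by (intro algebraic_int_mult[OF algebraic_int_prod rQ[OF ij]]) auto
    finally show ?thesis .
  qed
  moreover have "algebraic_int ?s" using r by (intro algebraic_int_prod) auto
  ultimately have "?s \<in> level Q"
    using Q by (simp add: level_def integral_mat_iff)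
  moreover obtain C where C: "ideal C \<O>\<^sub>K" "ideal_prod \<O>\<^sub>K P C = level Q"
    using lvl unfolding ideal_dvd_def by blast
  then have "level Q \<subseteq> P"
    using ring.ideal_prod_inter[OF cring.axioms(1)[OF cring_ring_of_integers] ideal C(1)] by blast
  moreover have "?s \<notin> P" using r by (intro P_prod) auto
  ultimately show False by blast
qed

theorem corollary2p11:
  fixes X :: "int mat" and Q Y :: "'k::field_char_0 mat" and P :: "'k set" and n :: nat
  assumes "number_field TYPE('k)"
    and "X \<in> carrier_mat n n" and "transpose_mat X = X"
    and "Q \<in> carrier_mat n n" and "Q \<noteq> 0\<^sub>m n n"
    and "integral_mat (transpose_mat Q * Q)"
    and "Y \<in> carrier_mat n n" and "integral_mat Y"
    and "map_mat of_int X * Q = Q * Y"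
    and "nonzero_prime_ideal P" and "ideal_dvd P (level Q)"
  shows "\<exists>p::nat. Factorial_Ring.prime p \<and> lies_above P p \<and> int p dvd mat_discriminant X \<and>
           (\<not> (int p)\<^sup>2 dvd mat_discriminant X \<longrightarrow>
              ramified TYPE('k) p \<and>
              ideal_dvd (ideal_prod \<O>\<^sub>K P P) (PIdl\<^bsub>\<O>\<^sub>K\<^esub> of_nat p))"
proof -
  interpret nonzero_prime P using assms(1,10) by unfold_locales
  obtain p where p: "Factorial_Ring.prime (p::nat)" "of_nat p \<in> P" by (rule prime_below)
  obtain i j where ij: "i < n" "j < n"
    and den: "\<And>r. algebraic_int r \<Longrightarrow> algebraic_int (r * Q $$ (i, j)) \<Longrightarrow> r \<in> P"
    using entry_denominator[OF assms(11,4)] by blast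
  have "of_int (mat_discriminant X) \<in> ideal_prod \<O>\<^sub>K P P"
  proof (cases "mat_discriminant X = 0")
    \<comment> \<open>A zero discriminant lies in every ideal; it is divisible by
      \<open>p\<^sup>2\<close>, so the second claim is then vacuous.\<close>
    case True
    then show ?thesis using ideal_ring_of_integersD(2)[OF ideal_square] by simp
  next
    case False
    then show ?thesis
      using algebraic_int_discriminant_mult_sq[OF assms(2-4,6-9) False ij]
      by (intro mem_square_if_denominator[OF den]) auto
  qed
  note * = square_cases[OF p this]
  show ?thesis
  proof (intro exI[of _ p] conjI impI)
    assume "\<not> (int p)\<^sup>2 dvd mat_discriminant X"
    then show "ideal_dvd (ideal_prod \<O>\<^sub>K P P) (PIdl\<^bsub>\<O>\<^sub>K\<^esub> of_nat p)"
      by (intro square_dvd *(2))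
    \<comment> \<open>\<open>P\<close> itself witnesses the ramification.\<close>
    then show "ramified TYPE('k) p" unfolding ramified_def using assms(10) by blast
  qed (use p *(1) lies_above[OF p] in auto)
qed

end
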